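(* Let $(\Omega,\Sigma,\mu)$ be a finite, positive, non-atomic measure space with $\mu(\Omega)>0$, let $\nu$ be any measure and write $L^\infty=L^\infty(\nu)$, and let $E$ be a Banach space. Fix $1\le q<p<\infty$ and $\sigma=1/q'$, where $1/q+1/q'=1$, and consider a linear operator $u:L^\infty(\nu)\to E$. (1) If the composition operator $\tilde u(f)=u\circ f$ is well defined and continuous from $\mathcal P_q^\sigma(\mu,L^\infty)$ to $\mathcal B_q(\mu,E)$, then $u$ is $p$-summing. (2) If $u$ is $q$-summing, then $\tilde u$ is well defined and continuous from $\mathcal P_q^\sigma(\mu,L^\infty)$ to $\mathcal B_q(\mu,E)$.
   Context: For $1\le p<\infty$ and a Banach space $X$, $\mathcal P_p(\mu,X)$ is the space of ($\mu$-a.e. classes of) strongly measurable Pettis $p$-integrable functions $f:\Omega\to X$ (Pettis integrable with $x'\circ f\in L^p(\mu)$ for all $x'\in X^*$) with norm $\|f\|_{\mathcal P_p}=\sup_{x'\in B_{X^*}}(\int|x'(f(w))|^p\,d\mu(w))^{1/p}$. $\mathcal B_p(\mu,X)$ is the space of Bochner $p$-integrable functions $f:\Omega\to X$ with norm $(\int\|f(w)\|^p\,d\mu(w))^{1/p}$. For $1\le p<\infty$, $0\le\sigma\le1$ let $\mathcal S_p^\sigma(\mu,X)$ be the space of $\mu$-classes of $X$-valued simple functions. For such $f$ put $$\Phi_{p,\sigma}(f)=\sup_{x'\in B_{X^*}}\Big(\int\big(|\langle f(w),x'\rangle|^{1-\sigma}\|f(w)\|^\sigma\big)^p\,d\mu(w)\Big)^{1/p}$$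 and $\|f\|_{p,\sigma}=\inf\{\sum_{i=1}^n\Phi_{p,\sigma}(f_i): f=\sum_{i=1}^n f_i,\ f_i\in\mathcal S_p^\sigma(\mu,X)\}$. This is a norm with $\|\cdot\|_{\mathcal P_p}\le\|\cdot\|_{p,\sigma}$. Define $\mathcal P_p^\sigma(\mu,X):=\overline{\mathcal S_p^\sigma(\mu,X)}\cap\mathcal P_p(\mu,X)$, where $\overline{\mathcal S_p^\sigma(\mu,X)}$ is the completion for $\|\cdot\|_{p,\sigma}$, with the norm induced by that completion; concretely, it consists of those $f\in\mathcal P_p(\mu,X)$ for which there is a $\|\cdot\|_{p,\sigma}$-Cauchy sequence $(f_n)$ of simple functions converging to $f$ in $\|\cdot\|_{\mathcal P_p}$, and the norm of $f$ is the infimum of $\lim_n\|f_n\|_{p,\sigma}$ over such sequences. "Well defined" means $u\circ f\in\mathcal B_q(\mu,E)$ for every $f$ in the domain. "$p$-summing" means absolutely $p$-summing. *)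

theory Defs
  imports "HOL-Probability.Probability" "HOL-Library.Function_Algebras"
begin

section \<open>Seminormed spaces of representatives\<close>

text \<open>
  The space \<open>L\<^sup>\<infinity>(\<nu>)\<close> depends on the term \<open>\<nu>\<close>, so it is not a type. It is represented by the
  linear space of essentially bounded functions with the essential supremum seminorm, and two
  functions at distance 0 stand for the same vector. Accordingly the vector-valued notions below
  are stated for a pair \<open>V, N\<close> of a linear subspace \<open>V\<close> of a real vector space and a seminorm \<open>N\<close>
  on \<open>V\<close>, and all of them are invariant under changes at distance 0. For a Banach space given as
  a type, \<open>V = UNIV\<close> and \<open>N = norm\<close>. The scalar field is \<open>\<real>\<close>.
\<close>

instantiation "fun" :: (type, scaleR) scaleR
begin

definition "scaleR c f = (\<lambda>x. c *\<^sub>R f x)"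

instance ..

end

instance "fun" :: (type, real_vector) real_vector
  by standard (simp_all add: fun_eq_iff scaleR_fun_def scaleR_add_right scaleR_add_left)

definition linear_on :: "'v::real_vector set \<Rightarrow> ('v \<Rightarrow> 'c::real_vector) \<Rightarrow> bool" where
  "linear_on V T \<longleftrightarrow>
     (\<forall>x\<in>V. \<forall>y\<in>V. T (x + y) = T x + T y) \<and> (\<forall>c. \<forall>x\<in>V. T (c *\<^sub>R x) = c *\<^sub>R T x)"

text \<open>Functionals are only constrained on \<open>V\<close>, and are only ever applied to elements of \<open>V\<close>.\<close>

definition dual_space :: "'v::real_vector set \<Rightarrow> ('v \<Rightarrow> real) \<Rightarrow> ('v \<Rightarrow> real) set" where
  "dual_space V N = {\<phi>. linear_on V \<phi> \<and> (\<exists>C. \<forall>x\<in>V. \<bar>\<phi> x\<bar> \<le> C * N x)}"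

definition dual_ball :: "'v::real_vector set \<Rightarrow> ('v \<Rightarrow> real) \<Rightarrow> ('v \<Rightarrow> real) set" where
  "dual_ball V N = {\<phi>. linear_on V \<phi> \<and> (\<forall>x\<in>V. \<bar>\<phi> x\<bar> \<le> N x)}"

text \<open>The supremum is over a nonempty bounded set.\<close>

definition p_summing ::
  "real \<Rightarrow> 'v::real_vector set \<Rightarrow> ('v \<Rightarrow> real) \<Rightarrow> ('v \<Rightarrow> 'e::real_normed_vector) \<Rightarrow> bool" where
  "p_summing p V N u \<longleftrightarrow>
     (\<exists>C\<ge>0. \<forall>(n::nat) x. (\<forall>i<n. x i \<in> V) \<longrightarrow>
        (\<Sum>i<n. norm (u (x i)) powr p) powr (1 / p)
          \<le> C * (SUP \<phi>\<in>dual_ball V N. (\<Sum>i<n. \<bar>\<phi> (x i)\<bar> powr p) powr (1 / p)))"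

section \<open>The space of essentially bounded functions\<close>

definition Linf :: "'b measure \<Rightarrow> ('b \<Rightarrow> real) set" where
  "Linf \<nu> = {g \<in> borel_measurable \<nu>. esssup \<nu> (\<lambda>x. ereal \<bar>g x\<bar>) < \<infinity>}"

text \<open>If \<open>\<nu> = 0\<close> the essential supremum is \<open>-\<infinity>\<close>, which \<^const>\<open>real_of_ereal\<close> sends to 0.\<close>

definition Linf_norm :: "'b measure \<Rightarrow> ('b \<Rightarrow> real) \<Rightarrow> real" where
  "Linf_norm \<nu> g = real_of_ereal (esssup \<nu> (\<lambda>x. ereal \<bar>g x\<bar>))"

section \<open>Vector-valued function spaces\<close>

definition non_atomic :: "'w measure \<Rightarrow> bool" where
  "non_atomic \<mu> \<longleftrightarrow>
     (\<forall>A\<in>sets \<mu>. emeasure \<mu> A > 0 \<longrightarrow>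
        (\<exists>B\<in>sets \<mu>. B \<subseteq> A \<and> 0 < emeasure \<mu> B \<and> emeasure \<mu> B < emeasure \<mu> A))"

text \<open>The power \<open>a\<^sup>r\<close> of an extended nonnegative real, for \<open>r > 0\<close>.\<close>

definition epowr :: "ennreal \<Rightarrow> real \<Rightarrow> ennreal" where
  "epowr a r = (if a = \<infinity> then \<infinity> else ennreal (enn2real a powr r))"

definition simple_functions :: "'w measure \<Rightarrow> 'v set \<Rightarrow> ('w \<Rightarrow> 'v) set" where
  "simple_functions \<mu> V = {f. simple_function \<mu> f \<and> f \<in> space \<mu> \<rightarrow> V}"

definition strongly_measurable ::
  "'w measure \<Rightarrow> 'v::real_vector set \<Rightarrow> ('v \<Rightarrow> real) \<Rightarrow> ('w \<Rightarrow> 'v) \<Rightarrow> bool" where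
  "strongly_measurable \<mu> V N f \<longleftrightarrow>
     f \<in> space \<mu> \<rightarrow> V \<and>
     (\<exists>s. (\<forall>n. s n \<in> simple_functions \<mu> V) \<and>
          (AE w in \<mu>. (\<lambda>n. N (s n w - f w)) \<longlonglongrightarrow> 0))"

definition bochner_norm ::
  "real \<Rightarrow> 'w measure \<Rightarrow> ('v \<Rightarrow> real) \<Rightarrow> ('w \<Rightarrow> 'v) \<Rightarrow> ennreal" where
  "bochner_norm p \<mu> N f =
     epowr (\<integral>\<^sup>+ w. ennreal (N (f w) powr p) \<partial>(completion \<mu>)) (1 / p)"

definition bochner_space ::
  "real \<Rightarrow> 'w measure \<Rightarrow> 'v::real_vector set \<Rightarrow> ('v \<Rightarrow> real) \<Rightarrow> ('w \<Rightarrow> 'v) set" where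
  "bochner_space p \<mu> V N = {f. strongly_measurable \<mu> V N f \<and> bochner_norm p \<mu> N f < \<infinity>}"

text \<open>
  Strong measurability is an almost-everywhere condition, so \<open>\<phi> \<circ> f\<close> is measurable only up to
  a null set. Scalar integrals are therefore taken over the completion of \<open>\<mu>\<close>.
\<close>

definition pettis_integrable ::
  "'w measure \<Rightarrow> 'v::real_vector set \<Rightarrow> ('v \<Rightarrow> real) \<Rightarrow> ('w \<Rightarrow> 'v) \<Rightarrow> bool" where
  "pettis_integrable \<mu> V N f \<longleftrightarrow>
     (\<forall>\<phi>\<in>dual_space V N. integrable (completion \<mu>) (\<lambda>w. \<phi> (f w))) \<and>
     (\<forall>A\<in>sets \<mu>. \<exists>x\<in>V. \<forall>\<phi>\<in>dual_space V N.
        \<phi> x = (LINT w:A|completion \<mu>. \<phi> (f w)))"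

definition pettis_space ::
  "real \<Rightarrow> 'w measure \<Rightarrow> 'v::real_vector set \<Rightarrow> ('v \<Rightarrow> real) \<Rightarrow> ('w \<Rightarrow> 'v) set" where
  "pettis_space p \<mu> V N =
     {f. strongly_measurable \<mu> V N f \<and> pettis_integrable \<mu> V N f \<and>
         (\<forall>\<phi>\<in>dual_space V N. integrable (completion \<mu>) (\<lambda>w. \<bar>\<phi> (f w)\<bar> powr p))}"

definition pettis_norm ::
  "real \<Rightarrow> 'w measure \<Rightarrow> 'v::real_vector set \<Rightarrow> ('v \<Rightarrow> real) \<Rightarrow> ('w \<Rightarrow> 'v) \<Rightarrow> ennreal" where
  "pettis_norm p \<mu> V N f =
     (SUP \<phi>\<in>dual_ball V N.
        epowr (\<integral>\<^sup>+ w. ennreal (\<bar>\<phi> (f w)\<bar> powr p) \<partial>(completion \<mu>)) (1 / p))"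

section \<open>The interpolated Pettis spaces\<close>

text \<open>
  In HOL \<open>0 powr 0 = 0\<close>. For \<open>\<sigma> = 0\<close> this is harmless, since \<open>N (f w) = 0\<close> forces \<open>\<phi> (f w) = 0\<close>.
  For \<open>\<sigma> = 1\<close> the supremum is still \<open>(\<integral> N (f w)\<^sup>p d\<mu>)\<^sup>1\<^sup>/\<^sup>p\<close>, since on the finitely many values of a
  simple function some \<open>\<phi>\<close> vanishes only where \<open>N\<close> does.
\<close>

definition Phi ::
  "real \<Rightarrow> real \<Rightarrow> 'w measure \<Rightarrow> 'v::real_vector set \<Rightarrow> ('v \<Rightarrow> real) \<Rightarrow> ('w \<Rightarrow> 'v) \<Rightarrow> ennreal" where
  "Phi p \<sigma> \<mu> V N f =
     (SUP \<phi>\<in>dual_ball V N.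
        epowr (\<integral>\<^sup>+ w. ennreal ((\<bar>\<phi> (f w)\<bar> powr (1 - \<sigma>) * N (f w) powr \<sigma>) powr p)
                 \<partial>(completion \<mu>)) (1 / p))"

definition sigma_norm ::
  "real \<Rightarrow> real \<Rightarrow> 'w measure \<Rightarrow> 'v::real_vector set \<Rightarrow> ('v \<Rightarrow> real) \<Rightarrow> ('w \<Rightarrow> 'v) \<Rightarrow> ennreal" where
  "sigma_norm p \<sigma> \<mu> V N f =
     Inf {(\<Sum>i<n. Phi p \<sigma> \<mu> V N (g i)) | (n::nat) g.
            (\<forall>i<n. g i \<in> simple_functions \<mu> V) \<and>
            (AE w in \<mu>. N (f w - (\<Sum>i<n. g i w)) = 0)}"

text \<open>\<^term>\<open>s\<close> is a sequence of simple functions which is Cauchy for \<^const>\<open>sigma_norm\<close> and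
  converges to \<^term>\<open>f\<close> for \<^const>\<open>pettis_norm\<close>.\<close>

definition sigma_approx ::
  "real \<Rightarrow> real \<Rightarrow> 'w measure \<Rightarrow> 'v::real_vector set \<Rightarrow> ('v \<Rightarrow> real) \<Rightarrow>
   (nat \<Rightarrow> 'w \<Rightarrow> 'v) \<Rightarrow> ('w \<Rightarrow> 'v) \<Rightarrow> bool" where
  "sigma_approx p \<sigma> \<mu> V N s f \<longleftrightarrow>
     (\<forall>n. s n \<in> simple_functions \<mu> V) \<and>
     (\<forall>e>0. \<exists>K. \<forall>m\<ge>K. \<forall>n\<ge>K. sigma_norm p \<sigma> \<mu> V N (s m - s n) < e) \<and>
     (\<lambda>n. pettis_norm p \<mu> V N (s n - f)) \<longlonglongrightarrow> 0"

definition pettis_sigma_space ::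
  "real \<Rightarrow> real \<Rightarrow> 'w measure \<Rightarrow> 'v::real_vector set \<Rightarrow> ('v \<Rightarrow> real) \<Rightarrow> ('w \<Rightarrow> 'v) set" where
  "pettis_sigma_space p \<sigma> \<mu> V N =
     {f \<in> pettis_space p \<mu> V N. \<exists>s. sigma_approx p \<sigma> \<mu> V N s f}"

definition pettis_sigma_norm ::
  "real \<Rightarrow> real \<Rightarrow> 'w measure \<Rightarrow> 'v::real_vector set \<Rightarrow> ('v \<Rightarrow> real) \<Rightarrow> ('w \<Rightarrow> 'v) \<Rightarrow> ennreal" where
  "pettis_sigma_norm p \<sigma> \<mu> V N f =
     Inf {L. \<exists>s. sigma_approx p \<sigma> \<mu> V N s f \<and> (\<lambda>n. sigma_norm p \<sigma> \<mu> V N (s n)) \<longlonglongrightarrow> L}"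

text \<open>Continuity on the set \<open>A\<close> with respect to the distances induced by two seminorms.\<close>

definition continuous_wrt ::
  "'f::minus set \<Rightarrow> ('f \<Rightarrow> ennreal) \<Rightarrow> ('g::minus \<Rightarrow> ennreal) \<Rightarrow> ('f \<Rightarrow> 'g) \<Rightarrow> bool" where
  "continuous_wrt A nA nB T \<longleftrightarrow>
     (\<forall>f\<in>A. \<forall>e>0. \<exists>d>0. \<forall>g\<in>A. nA (g - f) < d \<longrightarrow> nB (T g - T f) < e)"

end

theory Submission
  imports Defs
begin

text \<open>
  (2) If \<open>u\<close> is \<open>q\<close>-summing with constant \<open>C\<close>, the defining inequality applied to the suitably
  weighted values of a simple function bounds the Bochner norm of \<open>u \<circ> f\<close> by \<open>C\<close> times the Pettis
  norm of \<open>f\<close>. This extends to strongly measurable \<open>f\<close>, which are within \<open>e\<close> of a simple function on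
  sets exhausting the space, and the Pettis norm is dominated by the \<open>\<sigma>\<close>-norm.

  (1) Continuity, tested on simple functions carried by disjoint sets of positive measure, gives
  \<open>\<Sum>i. norm (u x\<^sub>i)\<^sup>q \<le> K * sup\<^sub>\<phi> (\<Sum>i. \<bar>\<phi> x\<^sub>i\<bar> * N x\<^sub>i\<^sup>q\<^sup>-\<^sup>1)\<close>. For each \<open>x\<close> in \<open>L\<^sup>\<infinity>\<close> some dyadic
  truncation \<open>y = x * 1\<^bsub>m/2 < \<bar>x\<bar> \<le> m\<^esub>\<close> carries enough of \<open>u x\<close>, in the sense that
  \<open>norm (u x)\<^sup>p \<le> K' * m\<^sup>p\<^sup>-\<^sup>q * norm (u y)\<^sup>q\<close>; here \<open>q < p\<close> is what makes the weights of the
  pigeonhole argument summable. Since \<open>\<bar>y\<bar>\<close> is comparable to \<open>m\<close> where it does not vanish, the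
  inequality for the rescaled \<open>y\<^sub>i\<close> bounds \<open>\<Sum>i. norm (u x\<^sub>i)\<^sup>p\<close> by the essential supremum of \<open>\<Sum>i. \<bar>x\<^sub>i\<bar>\<^sup>p\<close>. This is at most
  \<open>sup\<^sub>\<phi> (\<Sum>i. \<bar>\<phi> x\<^sub>i\<bar>\<^sup>p)\<close>, because limits along ultrafilters are functionals in the dual ball.
\<close>

section \<open>The norm of \<open>L\<^sup>p\<close> and Minkowski's inequality\<close>

text \<open>The integrand is constant on each of the finitely many fibres of \<open>f\<close>, and
  these are measurable. This converts integrals into the finite sums that appear in the definition
  of a summing operator.\<close>

lemma nn_integral_simple_function_compose:
  assumes f: "simple_function M f"
  shows "(\<integral>\<^sup>+ w. h (f w) \<partial>M) = (\<Sum>y\<in>f ` space M. h y * emeasure M (f -` {y} \<inter> space M))"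
proof -
  have fin: "finite (f ` space M)"
    using f by (rule simple_functionD)
  have ms: "f -` {y} \<inter> space M \<in> sets M" for y
    using f by (rule simple_functionD)
  have "(\<integral>\<^sup>+ w. h (f w) \<partial>M)
      = (\<integral>\<^sup>+ w. (\<Sum>y\<in>f ` space M. h y * indicator (f -` {y} \<inter> space M) w) \<partial>M)"
  proof (rule nn_integral_cong)
    fix w assume w: "w \<in> space M"
    have "(\<Sum>y\<in>f ` space M. h y * indicator (f -` {y} \<inter> space M) w)
        = (\<Sum>y\<in>f ` space M. if y = f w then h y else 0)"
      using w by (intro sum.cong) (auto simp: indicator_def)
    also have "\<dots> = h (f w)"
      using w fin by (simp add: sum.delta)
    finally show "h (f w) = (\<Sum>y\<in>f ` space M. h y * indicator (f -` {y} \<inter> space M) w)" ..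
  qed
  also have "\<dots> = (\<Sum>y\<in>f ` space M. h y * emeasure M (f -` {y} \<inter> space M))"
    using ms by (subst nn_integral_sum) (auto simp: nn_integral_cmult_indicator)
  finally show ?thesis .
qed

section \<open>Powers of extended nonnegative reals\<close>

lemma epowr_mono: "a \<le> b \<Longrightarrow> 0 \<le> r \<Longrightarrow> epowr a r \<le> epowr b r"
  by (cases a; cases b) (auto simp: epowr_def ennreal_leI powr_mono2 top_unique)

lemma epowr_ennreal: "0 \<le> x \<Longrightarrow> epowr (ennreal x) r = ennreal (x powr r)"
  by (simp add: epowr_def)

lemma epowr_eq_top_iff: "epowr a r = \<infinity> \<longleftrightarrow> a = \<infinity>"
  by (simp add: epowr_def)

lemma epowr_epowr: "epowr (epowr a r) s = epowr a (r * s)"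
  by (cases a) (auto simp: epowr_def powr_powr)

lemma epowr_one: "epowr a 1 = a"
  by (cases a) (auto simp: epowr_def)

text \<open>The exponents \<open>r\<close> and \<open>1 / r\<close> give mutually inverse monotone
  maps of the extended half line.\<close>

lemma epowr_le_iff:
  assumes "0 < r"
  shows "epowr a (1 / r) \<le> b \<longleftrightarrow> a \<le> epowr b r"
proof
  assume "epowr a (1 / r) \<le> b"
  then have "epowr (epowr a (1 / r)) r \<le> epowr b r"
    using assms by (intro epowr_mono) auto
  then show "a \<le> epowr b r"
    using assms by (simp add: epowr_epowr epowr_one)
next
  assume "a \<le> epowr b r"
  then have "epowr a (1 / r) \<le> epowr (epowr b r) (1 / r)"
    using assms by (intro epowr_mono) auto
  then show "epowr a (1 / r) \<le> b"
    using assms by (simp add: epowr_epowr epowr_one)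
qed

lemma epowr_le_ennreal_iff:
  assumes "0 < r" "0 \<le> t"
  shows "epowr a (1 / r) \<le> ennreal t \<longleftrightarrow> a \<le> ennreal (t powr r)"
  using assms by (simp add: epowr_le_iff epowr_ennreal)

text \<open>For finite factors this is the real identity. If a factor is infinite, the identity
  survives because \<open>epowr\<close> fixes both 0 and \<infinity>, including the convention that
  0 times \<infinity> is 0.\<close>

lemma epowr_mult:
  assumes "0 < r"
  shows "epowr (a * b) r = epowr a r * epowr b r"
proof (cases "a = \<infinity> \<or> b = \<infinity>")
  case True
  have *: "epowr x r = 0 \<longleftrightarrow> x = 0" for x
    using assms by (cases x) (auto simp: epowr_def)
  show ?thesis
  proof (cases "a = 0 \<or> b = 0")
    case T: True
    then show ?thesis
      by (auto simp: epowr_def)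
  next
    case False
    with True have "a * b = \<infinity>"
      by (auto simp: ennreal_mult_eq_top_iff)
    moreover have "epowr a r * epowr b r = \<infinity>"
      using True False by (auto simp: ennreal_mult_eq_top_iff * epowr_eq_top_iff[unfolded infinity_ennreal_def])
    ultimately show ?thesis
      by (simp add: epowr_def)
  qed
next
  case False
  then obtain x y where "a = ennreal x" "0 \<le> x" "b = ennreal y" "0 \<le> y"
    by (metis ennreal_cases infinity_ennreal_def)
  then show ?thesis
    by (simp add: epowr_ennreal powr_mult flip: ennreal_mult)
qed

section \<open>Convexity of the power and Minkowski's inequality\<close>

text \<open>Only the endpoint 0 needs an argument: there the claim reduces to
  \<open>t powr p \<le> t\<close> for \<open>t\<close> between 0 and 1.\<close>

lemma convex_on_powr:
  assumes "1 \<le> p"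
  shows "convex_on {0..} (\<lambda>x::real. x powr p)"
proof (rule convex_on_linorderI)
  fix t x y :: real
  assume t: "0 < t" "t < 1" and xy: "x \<in> {0..}" "y \<in> {0..}" "x < y"
  show "((1 - t) *\<^sub>R x + t *\<^sub>R y) powr p \<le> (1 - t) * x powr p + t * y powr p"
  proof (cases "x = 0")
    case True
    have "t powr p \<le> t powr 1"
      using assms t by (intro powr_mono') auto
    with True assms xy t show ?thesis
      by (auto simp: powr_mult intro: mult_right_mono)
  next
    case False
    with xy t powr_convex[OF assms] show ?thesis
      by (intro convex_onD) auto
  qed
qed simp

text \<open>The common form of \<open>bochner_norm\<close> and of each term in the supremum
  \<open>pettis_norm\<close>, so that one triangle inequality serves both. Values lie in
  \<open>ennreal\<close>, so no integrability has to be carried along.\<close>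

definition Lp_norm :: "real \<Rightarrow> 'a measure \<Rightarrow> ('a \<Rightarrow> real) \<Rightarrow> ennreal" where
  "Lp_norm p M f = epowr (\<integral>\<^sup>+ w. ennreal (\<bar>f w\<bar> powr p) \<partial>M) (1 / p)"

lemma Lp_norm_le_iff:
  "0 < p \<Longrightarrow> 0 \<le> t \<Longrightarrow> Lp_norm p M f \<le> ennreal t
    \<longleftrightarrow> (\<integral>\<^sup>+ w. ennreal (\<bar>f w\<bar> powr p) \<partial>M) \<le> ennreal (t powr p)"
  by (simp add: Lp_norm_def epowr_le_ennreal_iff)

lemma Lp_norm_mono_AE:
  assumes "0 < p" "AE w in M. \<bar>f w\<bar> \<le> \<bar>g w\<bar>"
  shows "Lp_norm p M f \<le> Lp_norm p M g"
  unfolding Lp_norm_def using assms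
  by (intro epowr_mono nn_integral_mono_AE) (auto elim!: eventually_mono intro!: ennreal_leI powr_mono2)

lemma Lp_norm_cong_AE:
  assumes "AE w in M. \<bar>f w\<bar> = \<bar>g w\<bar>"
  shows "Lp_norm p M f = Lp_norm p M g"
  unfolding Lp_norm_def using assms
  by (intro arg_cong[where f = "\<lambda>x. epowr x _"] nn_integral_cong_AE) (auto elim!: eventually_mono)

lemma Lp_norm_const:
  assumes "0 < p" "0 \<le> c"
  shows "Lp_norm p M (\<lambda>_. c) = ennreal c * epowr (emeasure M (space M)) (1 / p)"
  using assms by (simp add: Lp_norm_def epowr_mult epowr_ennreal powr_powr)

text \<open>Convexity of the power, with weights proportional to bounds for the norms of the summands.\<close>

lemma Lp_norm_sum_le:
  fixes f :: "'i \<Rightarrow> 'a \<Rightarrow> real"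
  assumes p: "1 \<le> p" and I: "finite I"
    and meas: "\<And>i. i \<in> I \<Longrightarrow> f i \<in> borel_measurable M"
  shows "Lp_norm p M (\<lambda>w. \<Sum>i\<in>I. f i w) \<le> (\<Sum>i\<in>I. Lp_norm p M (f i))"
proof (cases "I = {} \<or> (\<exists>i\<in>I. Lp_norm p M (f i) = \<infinity>)")
  case True
  then show ?thesis
  proof
    assume "I = {}"
    then show ?thesis
      using p by (simp add: Lp_norm_def epowr_def)
  next
    assume "\<exists>i\<in>I. Lp_norm p M (f i) = \<infinity>"
    then have "(\<Sum>i\<in>I. Lp_norm p M (f i)) = \<infinity>"
      using I by simp
    then show ?thesis
      by simp
  qed
next
  case False
  define a where "a i = enn2real (Lp_norm p M (f i))" for i
  have a: "Lp_norm p M (f i) = ennreal (a i)" "0 \<le> a i" if "i \<in> I" for i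
    using False that by (auto simp: a_def less_top)
  \<comment> \<open>The slack \<open>e\<close> keeps every weight \<open>b i\<close> strictly
    positive, also for summands of norm 0, so that dividing by \<open>b i\<close> is
    legitimate.\<close>
  have bound: "Lp_norm p M (\<lambda>w. \<Sum>i\<in>I. f i w) \<le> ennreal (\<Sum>i\<in>I. a i + e)" if e: "0 < e" for e
  proof -
    define b where "b i = a i + e" for i
    define S where "S = sum b I"
    have b: "0 < b i" if "i \<in> I" for i
      using a(2)[OF that] e by (simp add: b_def)
    have S: "0 < S"
      unfolding S_def using b I False by (intro sum_pos) auto
    have int: "(\<integral>\<^sup>+ w. ennreal (\<bar>f i w\<bar> powr p) \<partial>M) \<le> ennreal (b i powr p)" if "i \<in> I" for i
      using a[OF that] e p by (subst Lp_norm_le_iff[symmetric]) (auto simp: b_def intro!: ennreal_leI)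
    have conv: "\<bar>\<Sum>i\<in>I. f i w\<bar> powr p \<le> S powr p * (\<Sum>i\<in>I. b i / S * (\<bar>f i w\<bar> / b i) powr p)" for w
    proof -
      have "\<bar>\<Sum>i\<in>I. f i w\<bar> \<le> (\<Sum>i\<in>I. \<bar>f i w\<bar>)"
        by (rule sum_abs)
      also have "\<dots> = S * (\<Sum>i\<in>I. b i / S * (\<bar>f i w\<bar> / b i))"
        unfolding sum_distrib_left using S b[THEN less_imp_neq] by (intro sum.cong) auto
      finally have "\<bar>\<Sum>i\<in>I. f i w\<bar> powr p \<le> (S * (\<Sum>i\<in>I. b i / S * (\<bar>f i w\<bar> / b i))) powr p"
        using p by (intro powr_mono2) auto
      also have "\<dots> = S powr p * (\<Sum>i\<in>I. b i / S * (\<bar>f i w\<bar> / b i)) powr p"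
        by (rule powr_mult)
      also have "(\<Sum>i\<in>I. b i / S * (\<bar>f i w\<bar> / b i)) powr p \<le> (\<Sum>i\<in>I. b i / S * (\<bar>f i w\<bar> / b i) powr p)"
      proof -
        have "convex_on {0..} (\<lambda>x::real. x powr p)"
          using p by (rule convex_on_powr)
        then have "(\<lambda>x. x powr p) (\<Sum>i\<in>I. (b i / S) *\<^sub>R (\<bar>f i w\<bar> / b i))
            \<le> (\<Sum>i\<in>I. b i / S * (\<lambda>x. x powr p) (\<bar>f i w\<bar> / b i))"
          using I False S b
          by (intro convex_on_sum[where C = "{0..}"])
            (auto simp: S_def less_imp_le simp flip: sum_divide_distrib)
        then show ?thesis by simp
      qed
      finally show ?thesis
        by (simp add: mult_left_mono)
    qed
    have "(\<integral>\<^sup>+ w. ennreal (\<bar>\<Sum>i\<in>I. f i w\<bar> powr p) \<partial>M)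
        \<le> (\<integral>\<^sup>+ w. (\<Sum>i\<in>I. ennreal (S powr p * (b i / S) * (1 / b i) powr p) * ennreal (\<bar>f i w\<bar> powr p)) \<partial>M)"
    proof (intro nn_integral_mono)
      fix w
      have "(\<Sum>i\<in>I. ennreal (S powr p * (b i / S) * (1 / b i) powr p) * ennreal (\<bar>f i w\<bar> powr p))
          = ennreal (S powr p * (\<Sum>i\<in>I. b i / S * (\<bar>f i w\<bar> / b i) powr p))"
        unfolding sum_distrib_left using S b
        by (subst sum_ennreal[symmetric])
          (auto intro!: sum.cong simp: powr_divide less_imp_le mult_ac simp flip: ennreal_mult)
      then show "ennreal (\<bar>\<Sum>i\<in>I. f i w\<bar> powr p)
          \<le> (\<Sum>i\<in>I. ennreal (S powr p * (b i / S) * (1 / b i) powr p) * ennreal (\<bar>f i w\<bar> powr p))"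
        using conv[of w] by (simp add: ennreal_leI)
    qed
    also have "\<dots> = (\<Sum>i\<in>I. ennreal (S powr p * (b i / S) * (1 / b i) powr p) * (\<integral>\<^sup>+ w. ennreal (\<bar>f i w\<bar> powr p) \<partial>M))"
      using meas by (simp add: nn_integral_sum nn_integral_cmult)
    also have "\<dots> \<le> (\<Sum>i\<in>I. ennreal (S powr p * (b i / S) * (1 / b i) powr p) * ennreal (b i powr p))"
      by (intro sum_mono mult_left_mono int) auto
    also have "\<dots> = ennreal (\<Sum>i\<in>I. S powr p * (b i / S))"
      using b S by (subst sum_ennreal[symmetric])
        (auto intro!: arg_cong[where f = ennreal] sum.cong
          simp: powr_divide less_imp_le ennreal_mult[symmetric] less_imp_neq[OF b, symmetric])
    also have "(\<Sum>i\<in>I. S powr p * (b i / S)) = S powr p"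
      using S by (simp add: S_def flip: sum_distrib_left sum_divide_distrib)
    finally show ?thesis
      using S p by (subst Lp_norm_le_iff) (auto simp: S_def b_def)
  qed
  have "Lp_norm p M (\<lambda>w. \<Sum>i\<in>I. f i w) \<le> ennreal (\<Sum>i\<in>I. a i)"
  proof (rule ennreal_le_epsilon)
    fix e :: real assume "0 < e"
    have c: "0 < real (card I)"
      using False I by (simp add: card_gt_0_iff)
    have "Lp_norm p M (\<lambda>w. \<Sum>i\<in>I. f i w) \<le> ennreal (\<Sum>i\<in>I. a i + e / card I)"
      using \<open>0 < e\<close> c by (intro bound) simp
    also have "(\<Sum>i\<in>I. a i + e / card I) = (\<Sum>i\<in>I. a i) + e"
      using c by (simp add: sum.distrib)
    finally show "Lp_norm p M (\<lambda>w. \<Sum>i\<in>I. f i w) \<le> ennreal (\<Sum>i\<in>I. a i) + ennreal e"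
      using \<open>0 < e\<close> a(2) by (simp add: sum_nonneg)
  qed
  also have "\<dots> = (\<Sum>i\<in>I. Lp_norm p M (f i))"
    using a by (simp flip: sum_ennreal)
  finally show ?thesis .
qed

lemma Lp_norm_add_le:
  assumes "1 \<le> p" "f \<in> borel_measurable M" "g \<in> borel_measurable M"
  shows "Lp_norm p M (\<lambda>w. f w + g w) \<le> Lp_norm p M f + Lp_norm p M g"
  using Lp_norm_sum_le[of p "{False, True}" "\<lambda>b. if b then f else g" M] assms by (simp add: add.commute)

section \<open>Seminormed spaces and strong measurability\<close>

lemma linear_on_zero:
  assumes "linear_on V T" "subspace V"
  shows "T 0 = 0"
proof -
  have "T (0 *\<^sub>R 0) = 0 *\<^sub>R T 0"
    using assms by (metis linear_on_def subspace_0)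
  then show ?thesis by simp
qed

lemma linear_on_diff:
  assumes "linear_on V T" "subspace V" "x \<in> V" "y \<in> V"
  shows "T (x - y) = T x - T y"
proof -
  have "T (x + (-1) *\<^sub>R y) = T x + (-1) *\<^sub>R T y"
    using assms by (metis linear_on_def subspace_scale)
  then show ?thesis by simp
qed

lemma linear_on_sum:
  assumes "linear_on V T" "subspace V" "finite I" "\<And>i. i \<in> I \<Longrightarrow> x i \<in> V"
  shows "T (\<Sum>i\<in>I. x i) = (\<Sum>i\<in>I. T (x i))"
  using assms(3,4)
proof (induction I)
  case empty
  then show ?case using assms by (simp add: linear_on_zero)
next
  case (insert i I)
  then have "T (x i + sum x I) = T (x i) + T (sum x I)"
    using assms(1,2) by (metis insertCI linear_on_def subspace_sum)
  with insert show ?case by simp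
qed

section \<open>Limits and simple functions over the completed measure\<close>

text \<open>The function \<open>lim\<close> of the sequence is measurable everywhere, and
  \<open>g\<close> differs from it only on a null set, all of whose subsets are measurable in the
  completion.\<close>

lemma borel_measurable_completion_AE_LIMSEQ:
  fixes g :: "'a \<Rightarrow> real"
  assumes f: "\<And>n. f n \<in> borel_measurable (completion M)"
    and lim: "AE w in M. (\<lambda>n. f n w) \<longlonglongrightarrow> g w"
  shows "g \<in> borel_measurable (completion M)"
proof -
  define h where "h w = lim (\<lambda>n. f n w)" for w
  have h: "h \<in> borel_measurable (completion M)"
    unfolding h_def using f by (rule borel_measurable_lim_metric)
  have eq: "AE w in completion M. h w = g w"
    using AE_completion[OF lim] by eventually_elim (simp add: h_def limI)
  show ?thesis
  proof (rule measurableI)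
    fix A :: "real set" assume A: "A \<in> sets borel"
    show "g -` A \<inter> space (completion M) \<in> sets (completion M)"
    proof (rule completion.in_sets_AE)
      show "h -` A \<inter> space (completion M) \<in> sets (completion M)"
        using h A by (rule measurable_sets)
      show "AE x in completion M. (x \<in> h -` A \<inter> space (completion M)) = (x \<in> g -` A \<inter> space (completion M))"
        using eq by eventually_elim auto
    qed auto
  qed simp
qed

text \<open>The measure of a level set is absorbed as a factor with exponent \<open>1 / p\<close>,
  which turns the integral into the p-norm of a finite family. The values are enumerated by
  \<open>h\<close> because summing operators are tested on families indexed by
  \<open>i < n\<close>.\<close>

lemma Lp_norm_simple_function_compose:
  assumes "finite_measure M" "simple_function M f" "0 < p" "bij_betw h {..<n} (f ` space M)"
  shows "Lp_norm p M (\<lambda>w. g (f w))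
    = ennreal ((\<Sum>i<n. \<bar>measure M (f -` {h i} \<inter> space M) powr (1 / p) * g (h i)\<bar> powr p) powr (1 / p))"
proof -
  interpret finite_measure M by fact
  have "(\<integral>\<^sup>+ w. ennreal (\<bar>g (f w)\<bar> powr p) \<partial>M)
      = (\<Sum>y\<in>f ` space M. ennreal (\<bar>g y\<bar> powr p) * emeasure M (f -` {y} \<inter> space M))"
    by (rule nn_integral_simple_function_compose) fact
  also have "\<dots> = (\<Sum>i<n. ennreal (\<bar>g (h i)\<bar> powr p) * emeasure M (f -` {h i} \<inter> space M))"
    by (rule sum.reindex_bij_betw[symmetric]) fact
  also have "\<dots> = (\<Sum>i<n. ennreal (\<bar>measure M (f -` {h i} \<inter> space M) powr (1 / p) * g (h i)\<bar> powr p))"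
    using \<open>0 < p\<close>
    by (intro sum.cong) (auto simp: emeasure_eq_measure abs_mult powr_mult powr_powr mult.commute
        simp flip: ennreal_mult)
  also have "\<dots> = ennreal (\<Sum>i<n. \<bar>measure M (f -` {h i} \<inter> space M) powr (1 / p) * g (h i)\<bar> powr p)"
    by (rule sum_ennreal) simp
  finally show ?thesis
    by (simp add: Lp_norm_def epowr_ennreal sum_nonneg)
qed

lemma bochner_norm_eq_Lp_norm: "bochner_norm p \<mu> norm f = Lp_norm p (completion \<mu>) (\<lambda>w. norm (f w))"
  by (simp add: bochner_norm_def Lp_norm_def)

lemma pettis_norm_eq_SUP_Lp_norm:
  "pettis_norm p \<mu> V N f = (SUP \<phi>\<in>dual_ball V N. Lp_norm p (completion \<mu>) (\<lambda>w. \<phi> (f w)))"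
  by (simp add: pettis_norm_def Lp_norm_def)

lemma simple_functionsD:
  assumes "s \<in> simple_functions \<mu> V"
  shows "simple_function \<mu> s" "simple_function (completion \<mu>) s" "w \<in> space \<mu> \<Longrightarrow> s w \<in> V"
  using assms by (auto simp: simple_functions_def simple_function_completion)

lemma simple_functions_diff:
  assumes "s \<in> simple_functions \<mu> V" "t \<in> simple_functions \<mu> V" "subspace V"
  shows "s - t \<in> simple_functions \<mu> V"
  using assms simple_function_compose2[of \<mu> s t "(-)"]
  by (auto simp: simple_functions_def fun_diff_def Pi_iff intro: subspace_diff)

lemma simple_function_compose_borel_measurable:
  fixes g :: "'a \<Rightarrow> real"
  shows "simple_function M f \<Longrightarrow> (\<lambda>w. g (f w)) \<in> borel_measurable M"
  using borel_measurable_simple_function[OF simple_function_compose[of M f g]] by (simp add: comp_def)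

section \<open>Seminorms, dual balls and measurable compositions\<close>

text \<open>A seminorm and not a norm, since \<open>Linf_norm\<close> vanishes on every function
  that is zero almost everywhere.\<close>

locale seminorm_on =
  fixes V :: "'v::real_vector set" and N :: "'v \<Rightarrow> real"
  assumes subspace: "subspace V"
    and triangle: "x \<in> V \<Longrightarrow> y \<in> V \<Longrightarrow> N (x + y) \<le> N x + N y"
    and scale: "x \<in> V \<Longrightarrow> N (c *\<^sub>R x) = \<bar>c\<bar> * N x"
begin

lemma N_zero: "N 0 = 0"
  using scale[of 0 0] subspace by (simp add: subspace_0)

lemma N_diff: "x \<in> V \<Longrightarrow> y \<in> V \<Longrightarrow> N (x - y) \<le> N x + N y"
  using triangle[of x "-1 *\<^sub>R y"] scale[of y "-1"] subspace by (simp add: subspace_neg)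

lemma N_nonneg: "x \<in> V \<Longrightarrow> 0 \<le> N x"
  using N_diff[of x x] N_zero by simp

lemma N_minus_commute: "x \<in> V \<Longrightarrow> y \<in> V \<Longrightarrow> N (x - y) = N (y - x)"
  using scale[of "x - y" "-1"] subspace by (simp add: subspace_diff)

lemma N_le_add_diff:
  assumes "x \<in> V" "y \<in> V"
  shows "N x \<le> N y + N (x - y)"
  using triangle[of y "x - y"] assms subspace by (simp add: subspace_diff)

lemma abs_N_diff_le: "x \<in> V \<Longrightarrow> y \<in> V \<Longrightarrow> \<bar>N x - N y\<bar> \<le> N (x - y)"
  using N_le_add_diff[of x y] N_le_add_diff[of y x] N_minus_commute[of x y] by simp

lemma zero_in_dual_ball: "(\<lambda>_. 0) \<in> dual_ball V N"
  using N_nonneg by (auto simp: dual_ball_def linear_on_def)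

lemma dual_ballD:
  assumes "\<phi> \<in> dual_ball V N"
  shows "linear_on V \<phi>" "x \<in> V \<Longrightarrow> \<bar>\<phi> x\<bar> \<le> N x"
  using assms by (auto simp: dual_ball_def)

lemma strongly_measurable_simple:
  assumes "s \<in> simple_functions \<mu> V"
  shows "strongly_measurable \<mu> V N s"
  using assms N_zero by (auto simp: strongly_measurable_def simple_functions_def intro!: exI[of _ "\<lambda>_. s"])

lemma strongly_measurable_diff:
  assumes "strongly_measurable \<mu> V N f" "strongly_measurable \<mu> V N g"
  shows "strongly_measurable \<mu> V N (f - g)"
proof -
  obtain s t where s: "\<And>n. s n \<in> simple_functions \<mu> V" "AE w in \<mu>. (\<lambda>n. N (s n w - f w)) \<longlonglongrightarrow> 0"
    and t: "\<And>n. t n \<in> simple_functions \<mu> V" "AE w in \<mu>. (\<lambda>n. N (t n w - g w)) \<longlonglongrightarrow> 0"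
    and fg: "f \<in> space \<mu> \<rightarrow> V" "g \<in> space \<mu> \<rightarrow> V"
    using assms unfolding strongly_measurable_def by blast
  have "AE w in \<mu>. (\<lambda>n. N ((s n - t n) w - (f - g) w)) \<longlonglongrightarrow> 0"
    using s(2) t(2) AE_space
  proof eventually_elim
    case (elim w)
    have mem: "s n w - f w \<in> V" "t n w - g w \<in> V" "(s n - t n) w - (f - g) w \<in> V" for n
      using fg elim simple_functionsD(3)[OF s(1)] simple_functionsD(3)[OF t(1)] subspace
      by (auto intro!: subspace_diff)
    show ?case
    proof (rule tendsto_sandwich[OF _ _ tendsto_const])
      show "\<forall>\<^sub>F n in sequentially. 0 \<le> N ((s n - t n) w - (f - g) w)"
        using N_nonneg[OF mem(3)] by simp
      have "(s n - t n) w - (f - g) w = (s n w - f w) - (t n w - g w)" for n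
        by simp
      then have "N ((s n - t n) w - (f - g) w) \<le> N (s n w - f w) + N (t n w - g w)" for n
        using N_diff[OF mem(1,2)] by metis
      then show "\<forall>\<^sub>F n in sequentially. N ((s n - t n) w - (f - g) w) \<le> N (s n w - f w) + N (t n w - g w)"
        by simp
      show "(\<lambda>n. N (s n w - f w) + N (t n w - g w)) \<longlonglongrightarrow> 0"
        using tendsto_add[OF elim(1,2)] by simp
    qed
  qed
  moreover have "s n - t n \<in> simple_functions \<mu> V" for n
    using s(1) t(1) subspace by (rule simple_functions_diff)
  moreover have "f - g \<in> space \<mu> \<rightarrow> V"
    using fg subspace by (auto simp: Pi_iff intro: subspace_diff)
  ultimately show ?thesis
    unfolding strongly_measurable_def by (intro conjI exI[of _ "\<lambda>n. s n - t n"]) auto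
qed

text \<open>A Lipschitz map carries the approximating simple functions to real simple functions that
  still converge almost everywhere. It is applied to functionals, to \<open>N\<close> itself and to
  \<open>norm (u x)\<close>.\<close>

lemma strongly_measurable_Lipschitz_compose:
  fixes g :: "'v \<Rightarrow> real"
  assumes f: "strongly_measurable \<mu> V N f"
    and g: "\<And>x y. x \<in> V \<Longrightarrow> y \<in> V \<Longrightarrow> \<bar>g x - g y\<bar> \<le> C * N (x - y)"
  shows "(\<lambda>w. g (f w)) \<in> borel_measurable (completion \<mu>)"
proof -
  obtain s where s: "\<And>n. s n \<in> simple_functions \<mu> V" "AE w in \<mu>. (\<lambda>n. N (s n w - f w)) \<longlonglongrightarrow> 0"
    and fV: "f \<in> space \<mu> \<rightarrow> V"
    using f unfolding strongly_measurable_def by blast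
  show ?thesis
  proof (rule borel_measurable_completion_AE_LIMSEQ)
    show "(\<lambda>w. g (s n w)) \<in> borel_measurable (completion \<mu>)" for n
      using simple_functionsD(2)[OF s(1)] by (rule simple_function_compose_borel_measurable)
    show "AE w in \<mu>. (\<lambda>n. g (s n w)) \<longlonglongrightarrow> g (f w)"
      using s(2) AE_space
    proof eventually_elim
      case (elim w)
      show ?case
      proof (rule Lim_null_comparison[THEN LIM_zero_cancel])
        have "norm (g (s n w) - g (f w)) \<le> C * N (s n w - f w)" for n
          unfolding real_norm_def using elim(2) fV by (intro g simple_functionsD(3)[OF s(1)]) auto
        then show "\<forall>\<^sub>F n in sequentially. norm (g (s n w) - g (f w)) \<le> C * N (s n w - f w)"
          by simp
        show "(\<lambda>n. C * N (s n w - f w)) \<longlonglongrightarrow> 0"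
          using tendsto_mult_left[OF elim(1), of C] by simp
      qed
    qed
  qed
qed

text \<open>The factor 1 matches the form \<open>C * N (x - y)\<close> of the Lipschitz condition
  above.\<close>

lemma dual_ball_Lipschitz:
  assumes "\<phi> \<in> dual_ball V N" "x \<in> V" "y \<in> V"
  shows "\<bar>\<phi> x - \<phi> y\<bar> \<le> 1 * N (x - y)"
  using dual_ballD(2)[OF assms(1), of "x - y"] linear_on_diff[OF dual_ballD(1)[OF assms(1)] subspace assms(2,3)]
    assms subspace by (simp add: subspace_diff)

lemma borel_measurable_dual_ball_compose:
  assumes "strongly_measurable \<mu> V N f" "\<phi> \<in> dual_ball V N"
  shows "(\<lambda>w. \<phi> (f w)) \<in> borel_measurable (completion \<mu>)"
  using assms(1) dual_ball_Lipschitz[OF assms(2)] by (rule strongly_measurable_Lipschitz_compose)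

lemma borel_measurable_N_compose:
  assumes "strongly_measurable \<mu> V N f"
  shows "(\<lambda>w. N (f w)) \<in> borel_measurable (completion \<mu>)"
  using assms by (rule strongly_measurable_Lipschitz_compose[where C = 1]) (simp add: abs_N_diff_le)

end

section \<open>Summing operators and the Pettis norm\<close>

text \<open>Monotone convergence: the absolute values of the restrictions to \<open>A k\<close>
  increase to that of \<open>f\<close> almost everywhere. Estimates are thereby needed only on sets
  where \<open>f\<close> is uniformly close to a simple function.\<close>

lemma Lp_norm_le_of_exhaustion:
  assumes p: "0 < p" and f: "f \<in> borel_measurable M"
    and A: "incseq A" "\<And>k. A k \<in> sets M" "AE w in M. w \<in> (\<Union>k. A k)"
    and bound: "\<And>k. Lp_norm p M (\<lambda>w. f w * indicator (A k) w) \<le> c"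
  shows "Lp_norm p M f \<le> c"
proof -
  have "(\<integral>\<^sup>+ w. ennreal (\<bar>f w\<bar> powr p) \<partial>M)
      = (\<integral>\<^sup>+ w. (SUP k. ennreal (\<bar>f w * indicator (A k) w\<bar> powr p)) \<partial>M)"
  proof (intro nn_integral_cong_AE)
    show "AE w in M. ennreal (\<bar>f w\<bar> powr p) = (SUP k. ennreal (\<bar>f w * indicator (A k) w\<bar> powr p))"
      using A(3)
    proof eventually_elim
      case (elim w)
      then obtain k where "w \<in> A k" by blast
      then show ?case
        by (intro antisym SUP_least SUP_upper2[of k]) (auto simp: indicator_def)
    qed
  qed
  also have "\<dots> = (SUP k. \<integral>\<^sup>+ w. ennreal (\<bar>f w * indicator (A k) w\<bar> powr p) \<partial>M)"
  proof (rule nn_integral_monotone_convergence_SUP)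
    show "incseq (\<lambda>k w. ennreal (\<bar>f w * indicator (A k) w\<bar> powr p))"
      using A(1) by (intro incseq_SucI le_funI ennreal_leI)
        (auto simp: indicator_def incseq_Suc_iff subset_eq)
  qed (use f A(2) in measurable)
  also have "\<dots> \<le> epowr c p"
    using bound p by (intro SUP_least) (simp add: Lp_norm_def epowr_le_iff)
  finally show ?thesis
    using p by (simp add: Lp_norm_def epowr_le_iff)
qed

text \<open>Built by recursion on \<open>k\<close>: wherever \<open>P k\<close> holds, the new
  function \<open>s k\<close> overrides the previous choice. With \<open>P n w\<close> saying that
  \<open>s n\<close> is close to \<open>f\<close> at \<open>w\<close>, this yields one simple
  function close to \<open>f\<close> on the union of the first \<open>k\<close> good sets.\<close>

lemma simple_function_select:
  assumes s: "\<And>n::nat. simple_function M (s n)" "\<And>n. s n \<in> space M \<rightarrow> V"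
    and D: "\<And>n. {w \<in> space M. P n w} \<in> sets M" and z: "z \<in> V"
  shows "\<exists>T. simple_function M T \<and> T \<in> space M \<rightarrow> V \<and>
    (\<forall>w\<in>space M. (\<exists>n<k. P n w \<and> T w = s n w) \<or> (\<forall>n<k. \<not> P n w) \<and> T w = z)"
proof (induction k)
  case 0
  then show ?case using z by (intro exI[of _ "\<lambda>_. z"]) auto
next
  case (Suc k)
  then obtain T where T: "simple_function M T" "T \<in> space M \<rightarrow> V"
    "\<forall>w\<in>space M. (\<exists>n<k. P n w \<and> T w = s n w) \<or> (\<forall>n<k. \<not> P n w) \<and> T w = z"
    by (elim exE conjE)
  have "simple_function M (\<lambda>w. if P k w then s k w else T w)"
    using s(1) T(1) D by (rule simple_function_If)
  moreover have "(\<lambda>w. if P k w then s k w else T w) \<in> space M \<rightarrow> V"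
    using s(2) T(2) by (auto simp: Pi_iff)
  moreover have "\<forall>w\<in>space M. (\<exists>n<Suc k. P n w \<and> (if P k w then s k w else T w) = s n w)
      \<or> (\<forall>n<Suc k. \<not> P n w) \<and> (if P k w then s k w else T w) = z"
  proof
    fix w assume "w \<in> space M"
    with T(3) have "(\<exists>n<k. P n w \<and> T w = s n w) \<or> (\<forall>n<k. \<not> P n w) \<and> T w = z"
      by (rule bspec)
    then show "(\<exists>n<Suc k. P n w \<and> (if P k w then s k w else T w) = s n w)
      \<or> (\<forall>n<Suc k. \<not> P n w) \<and> (if P k w then s k w else T w) = z"
      by (cases "P k w") (auto simp: less_Suc_eq)
  qed
  ultimately show ?case by (intro exI conjI)
qed

section \<open>Summing operators bound the Bochner norm by the Pettis norm\<close>

text \<open>An arbitrary upper bound \<open>t\<close> replaces the supremum over the dual ball, so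
  that no boundedness of that supremum has to be shown at each use. The constant is strictly
  positive because it is later divided by.\<close>

definition summing_const ::
  "real \<Rightarrow> 'v::real_vector set \<Rightarrow> ('v \<Rightarrow> real) \<Rightarrow> ('v \<Rightarrow> 'e::real_normed_vector) \<Rightarrow> real \<Rightarrow> bool" where
  "summing_const q V N u C \<longleftrightarrow> 0 < C \<and>
     (\<forall>(n::nat) x t. (\<forall>i<n. x i \<in> V) \<longrightarrow>
        (\<forall>\<phi>\<in>dual_ball V N. (\<Sum>i<n. \<bar>\<phi> (x i)\<bar> powr q) powr (1 / q) \<le> t) \<longrightarrow>
        (\<Sum>i<n. norm (u (x i)) powr q) powr (1 / q) \<le> C * t)"

context seminorm_on
begin

lemma p_summing_imp_summing_const:
  assumes "p_summing q V N u"
  shows "\<exists>C. summing_const q V N u C"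
proof -
  obtain C where C: "0 \<le> C" "\<And>(n::nat) x. (\<forall>i<n. x i \<in> V) \<Longrightarrow>
        (\<Sum>i<n. norm (u (x i)) powr q) powr (1 / q)
          \<le> C * (SUP \<phi>\<in>dual_ball V N. (\<Sum>i<n. \<bar>\<phi> (x i)\<bar> powr q) powr (1 / q))"
    using assms unfolding p_summing_def by blast
  have "(\<Sum>i<n. norm (u (x i)) powr q) powr (1 / q) \<le> (C + 1) * t"
    if x: "\<forall>i<n. x i \<in> V"
      and t: "\<And>\<phi>. \<phi>\<in>dual_ball V N \<Longrightarrow> (\<Sum>i<n. \<bar>\<phi> (x i)\<bar> powr q) powr (1 / q) \<le> t"
    for n :: nat and x t
  proof -
    have "0 \<le> t"
      using t[OF zero_in_dual_ball] by (rule order_trans[rotated]) simp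
    have "(SUP \<phi>\<in>dual_ball V N. (\<Sum>i<n. \<bar>\<phi> (x i)\<bar> powr q) powr (1 / q)) \<le> t"
      using t zero_in_dual_ball by (intro cSUP_least) auto
    then have "C * (SUP \<phi>\<in>dual_ball V N. (\<Sum>i<n. \<bar>\<phi> (x i)\<bar> powr q) powr (1 / q)) \<le> (C + 1) * t"
      using C(1) \<open>0 \<le> t\<close> by (smt (verit) mult_left_mono mult_right_mono)
    with C(2)[OF x] show ?thesis by simp
  qed
  with C(1) have "summing_const q V N u (C + 1)"
    unfolding summing_const_def by simp
  then show ?thesis ..
qed

text \<open>A family with a single vector has weak norm at most \<open>N x\<close>.\<close>

lemma summing_const_bound:
  assumes "summing_const q V N u C" "0 < q" "x \<in> V"
  shows "norm (u x) \<le> C * N x"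
proof -
  have "(\<Sum>i<1::nat. norm (u x) powr q) powr (1 / q) \<le> C * N x"
    using assms dual_ballD(2)
    by (intro assms(1)[unfolded summing_const_def, THEN conjunct2, rule_format]) (auto simp: powr_powr)
  then show ?thesis
    using assms by (simp add: powr_powr)
qed

text \<open>The summing inequality is applied to the values \<open>h i\<close> scaled by
  \<open>c i\<close>, the q-th root of the measure of their level set. Both sides then become
  \<open>Lp_norm\<close> of a composition with \<open>f\<close>.\<close>

lemma summing_const_simple:
  assumes u: "summing_const q V N u C" "linear_on V u" and q: "0 < q"
    and M: "finite_measure M" and f: "simple_function M f" "f \<in> space M \<rightarrow> V" and t: "0 \<le> t"
    and weak: "\<And>\<phi>. \<phi> \<in> dual_ball V N \<Longrightarrow> Lp_norm q M (\<lambda>w. \<phi> (f w)) \<le> ennreal t"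
  shows "Lp_norm q M (\<lambda>w. norm (u (f w))) \<le> ennreal (C * t)"
proof -
  obtain h where h: "bij_betw h {..<card (f ` space M)} (f ` space M)"
    using ex_bij_betw_nat_finite[OF simple_functionD(1)[OF f(1)]] by (auto simp: atLeast0LessThan)
  define n where "n = card (f ` space M)"
  define c where "c i = measure M (f -` {h i} \<inter> space M) powr (1 / q)" for i
  have norm_eq: "Lp_norm q M (\<lambda>w. g (f w)) = ennreal ((\<Sum>i<n. \<bar>c i * g (h i)\<bar> powr q) powr (1 / q))" for g
    using Lp_norm_simple_function_compose[OF M f(1) q h] by (simp add: c_def n_def)
  have hV: "h i \<in> V" if "i < n" for i
    using bij_betw_apply[OF h, of i] f(2) that by (auto simp: n_def)
  have "(\<Sum>i<n. norm (u (c i *\<^sub>R h i)) powr q) powr (1 / q) \<le> C * t"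
  proof (rule u(1)[unfolded summing_const_def, THEN conjunct2, rule_format])
    show "c i *\<^sub>R h i \<in> V" if "i < n" for i
      using hV[OF that] subspace by (rule subspace_scale[rotated])
    fix \<phi> assume \<phi>: "\<phi> \<in> dual_ball V N"
    have "(\<Sum>i<n. \<bar>\<phi> (c i *\<^sub>R h i)\<bar> powr q) = (\<Sum>i<n. \<bar>c i * \<phi> (h i)\<bar> powr q)"
      using hV dual_ballD(1)[OF \<phi>] by (intro sum.cong) (auto simp: linear_on_def)
    with weak[OF \<phi>] t show "(\<Sum>i<n. \<bar>\<phi> (c i *\<^sub>R h i)\<bar> powr q) powr (1 / q) \<le> t"
      by (simp add: norm_eq)
  qed
  moreover have "(\<Sum>i<n. norm (u (c i *\<^sub>R h i)) powr q) = (\<Sum>i<n. \<bar>c i * norm (u (h i))\<bar> powr q)"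
    using hV u(2) by (intro sum.cong) (auto simp: linear_on_def abs_mult)
  ultimately show ?thesis
    using norm_eq[of "\<lambda>x. norm (u x)"] by (simp add: ennreal_leI)
qed

text \<open>On the set \<open>A k\<close>, where one of the first \<open>k\<close> approximants is
  within \<open>e\<close> of \<open>f\<close>, the function is replaced by a simple
  \<open>T\<close>, for which the inequality is known. Letting \<open>k\<close> grow exhausts the
  space, and then \<open>e\<close> tends to 0.\<close>

lemma summing_const_strongly_measurable:
  assumes u: "summing_const q V N u C" "linear_on V u" and q: "1 \<le> q"
    and \<mu>: "finite_measure \<mu>" and f: "strongly_measurable \<mu> V N f" and t: "0 \<le> t"
    and weak: "\<And>\<phi>. \<phi> \<in> dual_ball V N \<Longrightarrow> Lp_norm q (completion \<mu>) (\<lambda>w. \<phi> (f w)) \<le> ennreal t"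
  shows "Lp_norm q (completion \<mu>) (\<lambda>w. norm (u (f w))) \<le> ennreal (C * t)"
proof -
  let ?M = "completion \<mu>"
  interpret M: finite_measure ?M
    using finite_measure.emeasure_finite[OF \<mu>] by (intro finite_measureI) simp
  have C: "0 < C" "norm (u x) \<le> C * N x" if "x \<in> V" for x
    using u(1) summing_const_bound[OF u(1)] q that by (auto simp: summing_const_def)
  \<comment> \<open>The norm of the constant function 1, so that a uniform error \<open>e\<close>
    has norm \<open>e * m\<close>.\<close>
  define m where "m = measure ?M (space ?M) powr (1 / q)"
  have m: "0 \<le> m" "epowr (emeasure ?M (space ?M)) (1 / q) = ennreal m"
    unfolding m_def M.emeasure_eq_measure by (simp_all add: epowr_ennreal)
  obtain s where s: "\<And>n. s n \<in> simple_functions \<mu> V" "AE w in \<mu>. (\<lambda>n. N (s n w - f w)) \<longlonglongrightarrow> 0"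
    and fV: "f \<in> space \<mu> \<rightarrow> V"
    using f unfolding strongly_measurable_def by blast
  have sV: "s n w \<in> V" if "w \<in> space \<mu>" for n w
    using s(1) that by (rule simple_functionsD(3))
  have meas_u: "(\<lambda>w. norm (u (f w))) \<in> borel_measurable ?M"
  proof (rule strongly_measurable_Lipschitz_compose[OF f])
    fix x y assume xy: "x \<in> V" "y \<in> V"
    have "\<bar>norm (u x) - norm (u y)\<bar> \<le> norm (u x - u y)"
      by (rule norm_triangle_ineq3)
    also have "\<dots> = norm (u (x - y))"
      using linear_on_diff[OF u(2) subspace xy] by simp
    also have "\<dots> \<le> C * N (x - y)"
      using xy subspace by (intro C) (rule subspace_diff)
    finally show "\<bar>norm (u x) - norm (u y)\<bar> \<le> C * N (x - y)" .
  qed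
  have meas_N: "(\<lambda>w. N (s n w - f w)) \<in> borel_measurable ?M" for n
    using borel_measurable_N_compose[OF strongly_measurable_diff[OF strongly_measurable_simple[OF s(1)] f]]
    by simp
  have level: "{w \<in> space ?M. N (s n w - f w) \<le> e} \<in> sets ?M" for n e
    using borel_measurable_le[OF meas_N borel_measurable_const] by simp
  \<comment> \<open>The summand \<open>e * m\<close> is the cost of replacing \<open>f\<close> by
    \<open>T\<close> in the weak norms, and \<open>C * e * m\<close> the cost of returning from
    \<open>u (T w)\<close> to \<open>u (f w)\<close>.\<close>
  have bound: "Lp_norm q ?M (\<lambda>w. norm (u (f w))) \<le> ennreal (C * (t + e * m) + C * e * m)" if e: "0 < e" for e
  proof (rule Lp_norm_le_of_exhaustion)
    define A where "A k = {w \<in> space ?M. \<exists>n<k. N (s n w - f w) \<le> e}" for k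
    show "0 < q" using q by simp
    show "(\<lambda>w. norm (u (f w))) \<in> borel_measurable ?M" by (rule meas_u)
    show "incseq A"
      unfolding A_def incseq_def by (auto intro: less_le_trans)
    show "A k \<in> sets ?M" for k
    proof -
      have "A k = (\<Union>n<k. {w \<in> space ?M. N (s n w - f w) \<le> e})"
        by (auto simp: A_def)
      then show ?thesis using level by auto
    qed
    show "AE w in ?M. w \<in> (\<Union>k. A k)"
      using AE_completion[OF s(2)] AE_space
    proof eventually_elim
      case (elim w)
      have "\<forall>\<^sub>F n in sequentially. N (s n w - f w) < e"
        using elim(1) e by (rule order_tendstoD(2))
      then obtain n where "N (s n w - f w) < e"
        by (meson eventually_happens trivial_limit_sequentially)
      then have "w \<in> A (Suc n)"
        using elim(2) by (auto simp: A_def intro: less_imp_le)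
      then show ?case by blast
    qed
    show "Lp_norm q ?M (\<lambda>w. norm (u (f w)) * indicator (A k) w) \<le> ennreal (C * (t + e * m) + C * e * m)" for k
    proof -
      have "\<exists>T. simple_function ?M T \<and> T \<in> space ?M \<rightarrow> V \<and>
        (\<forall>w\<in>space ?M. (\<exists>n<k. N (s n w - f w) \<le> e \<and> T w = s n w) \<or> (\<forall>n<k. \<not> N (s n w - f w) \<le> e) \<and> T w = 0)"
        using level sV subspace
        by (intro simple_function_select simple_functionsD(2)[OF s(1)]) (simp_all add: Pi_iff subspace_0)
      then obtain T where T: "simple_function ?M T" "T \<in> space ?M \<rightarrow> V"
        and T': "\<forall>w\<in>space ?M. (\<exists>n<k. N (s n w - f w) \<le> e \<and> T w = s n w)
          \<or> (\<forall>n<k. \<not> N (s n w - f w) \<le> e) \<and> T w = 0"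
        by (elim exE conjE)
      have close: "N (T w - f w) \<le> e" if "w \<in> A k" for w
        using bspec[OF T', of w] that by (auto simp: A_def)
      \<comment> \<open>Off \<open>A k\<close> the selected value is 0, so \<open>T\<close>
        contributes nothing to any weak norm there.\<close>
      have off: "T w = 0" if "w \<in> space ?M" "w \<notin> A k" for w
        using bspec[OF T', of w] that by (auto simp: A_def)
      have "Lp_norm q ?M (\<lambda>w. norm (u (T w))) \<le> ennreal (C * (t + e * m))"
      proof (rule summing_const_simple[OF u _ M.finite_measure_axioms T])
        show "0 < q" "0 \<le> t + e * m" using q t e m by auto
        fix \<phi> assume \<phi>: "\<phi> \<in> dual_ball V N"
        have "Lp_norm q ?M (\<lambda>w. \<phi> (T w)) \<le> Lp_norm q ?M (\<lambda>w. \<bar>\<phi> (f w)\<bar> + e)"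
        proof (rule Lp_norm_mono_AE)
          show "AE w in ?M. \<bar>\<phi> (T w)\<bar> \<le> \<bar>\<bar>\<phi> (f w)\<bar> + e\<bar>"
          proof (rule AE_I2)
            fix w assume w: "w \<in> space ?M"
            show "\<bar>\<phi> (T w)\<bar> \<le> \<bar>\<bar>\<phi> (f w)\<bar> + e\<bar>"
            proof (cases "w \<in> A k")
              case True
              have "\<bar>\<phi> (T w) - \<phi> (f w)\<bar> \<le> 1 * N (T w - f w)"
                using w T(2) fV by (intro dual_ball_Lipschitz[OF \<phi>]) auto
              with close[OF True] show ?thesis by simp
            next
              case False
              with off[OF w] e linear_on_zero[OF dual_ballD(1)[OF \<phi>] subspace] show ?thesis
                by simp
            qed
          qed
        qed (use q in simp)
        also have "\<dots> \<le> Lp_norm q ?M (\<lambda>w. \<bar>\<phi> (f w)\<bar>) + Lp_norm q ?M (\<lambda>_. e)"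
          using q borel_measurable_dual_ball_compose[OF f \<phi>] by (intro Lp_norm_add_le) auto
        also have "Lp_norm q ?M (\<lambda>w. \<bar>\<phi> (f w)\<bar>) = Lp_norm q ?M (\<lambda>w. \<phi> (f w))"
          by (simp add: Lp_norm_def)
        also have "Lp_norm q ?M (\<lambda>_. e) = ennreal (e * m)"
          using q e m by (subst Lp_norm_const) (auto simp: ennreal_mult)
        also have "Lp_norm q ?M (\<lambda>w. \<phi> (f w)) + ennreal (e * m) \<le> ennreal (t + e * m)"
          using weak[OF \<phi>] t e m by (simp add: add_right_mono)
        finally show "Lp_norm q ?M (\<lambda>w. \<phi> (T w)) \<le> ennreal (t + e * m)" .
      qed
      have "Lp_norm q ?M (\<lambda>w. norm (u (f w)) * indicator (A k) w)
          \<le> Lp_norm q ?M (\<lambda>w. norm (u (T w)) + C * e)"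
      proof (rule Lp_norm_mono_AE)
        show "AE w in ?M. \<bar>norm (u (f w)) * indicator (A k) w\<bar> \<le> \<bar>norm (u (T w)) + C * e\<bar>"
        proof (rule AE_I2)
          fix w assume w: "w \<in> space ?M"
          then have mem: "T w \<in> V" "f w \<in> V" "T w - f w \<in> V"
            using T(2) fV subspace by (auto intro!: subspace_diff)
          have "norm (u (f w)) \<le> norm (u (T w)) + C * e" if "w \<in> A k"
          proof -
            have "norm (u (f w)) \<le> norm (u (T w)) + norm (u (T w) - u (f w))"
              by norm
            also have "u (T w) - u (f w) = u (T w - f w)"
              using linear_on_diff[OF u(2) subspace mem(1,2)] by simp
            also have "norm (u (T w - f w)) \<le> C * N (T w - f w)"
              using mem by (intro C)
            also have "C * N (T w - f w) \<le> C * e"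
              using close[OF that] C(1)[OF mem(1)] by simp
            finally show ?thesis by simp
          qed
          then show "\<bar>norm (u (f w)) * indicator (A k) w\<bar> \<le> \<bar>norm (u (T w)) + C * e\<bar>"
            using C(1)[OF mem(1)] e by (auto simp: indicator_def)
        qed
      qed (use q in simp)
      also have "\<dots> \<le> Lp_norm q ?M (\<lambda>w. norm (u (T w))) + Lp_norm q ?M (\<lambda>_. C * e)"
        using q simple_function_compose_borel_measurable[OF T(1)] by (intro Lp_norm_add_le) auto
      also have "Lp_norm q ?M (\<lambda>_. C * e) = ennreal (C * e * m)"
        using q e m u(1) by (subst Lp_norm_const) (auto simp: ennreal_mult summing_const_def)
      also have "Lp_norm q ?M (\<lambda>w. norm (u (T w))) + ennreal (C * e * m) \<le> ennreal (C * (t + e * m)) + ennreal (C * e * m)"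
        by (intro add_right_mono) fact
      also have "\<dots> = ennreal (C * (t + e * m) + C * e * m)"
        using u(1) e m t by (subst ennreal_plus) (auto simp: summing_const_def)
      finally show ?thesis .
    qed
  qed
  have C0: "0 < C" using u(1) by (simp add: summing_const_def)
  show ?thesis
  proof (rule ennreal_le_epsilon)
    fix e :: real assume e: "0 < e"
    \<comment> \<open>The two errors add up to \<open>2 * C * d * m\<close>; the added 1 keeps the
      denominator positive when \<open>m\<close> is 0.\<close>
    define d where "d = e / (2 * C * m + 1)"
    have pos: "0 < 2 * C * m + 1"
      using C0 m by (simp add: add_nonneg_pos)
    then have d: "0 < d" "d * (2 * C * m + 1) = e"
      using e by (auto simp: d_def)
    have "C * (t + d * m) + C * d * m \<le> C * t + e"
      using d by (simp add: algebra_simps)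
    then have "ennreal (C * (t + d * m) + C * d * m) \<le> ennreal (C * t) + ennreal e"
      using C0 t e by (simp add: ennreal_leI flip: ennreal_plus)
    with bound[OF d(1)] show "Lp_norm q ?M (\<lambda>w. norm (u (f w))) \<le> ennreal (C * t) + ennreal e"
      by (rule order_trans)
  qed
qed

lemma bochner_norm_compose_le_pettis_norm:
  assumes u: "summing_const q V N u C" "linear_on V u" and q: "1 \<le> q"
    and \<mu>: "finite_measure \<mu>" and f: "strongly_measurable \<mu> V N f"
  shows "bochner_norm q \<mu> norm (u \<circ> f) \<le> ennreal C * pettis_norm q \<mu> V N f"
proof (cases "pettis_norm q \<mu> V N f")
  case (real t)
  have "Lp_norm q (completion \<mu>) (\<lambda>w. norm (u (f w))) \<le> ennreal (C * t)"
  proof (rule summing_const_strongly_measurable[OF u q \<mu> f])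
    fix \<phi> assume "\<phi> \<in> dual_ball V N"
    then have "Lp_norm q (completion \<mu>) (\<lambda>w. \<phi> (f w)) \<le> pettis_norm q \<mu> V N f"
      unfolding pettis_norm_eq_SUP_Lp_norm by (rule SUP_upper)
    with real show "Lp_norm q (completion \<mu>) (\<lambda>w. \<phi> (f w)) \<le> ennreal t"
      by simp
  qed (use real in simp)
  with real u(1) show ?thesis
    by (simp add: bochner_norm_eq_Lp_norm ennreal_mult summing_const_def)
next
  \<comment> \<open>Positivity of \<open>C\<close> makes the right-hand side infinite.\<close>
  case top
  with u(1) show ?thesis
    by (simp add: summing_const_def ennreal_mult_top)
qed

end

section \<open>Comparison of the Pettis norm with the \<sigma>-norm, and continuity for summing
  operators\<close>

context seminorm_on
begin

text \<open>Split \<bar>\<phi> x\<bar> into its powers with exponents 1 - \<sigma> and \<sigma>, and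
  bound the second factor by the corresponding power of \<open>N x\<close>.\<close>

lemma Lp_norm_dual_ball_le_Phi:
  assumes \<sigma>: "0 \<le> \<sigma>" "\<sigma> \<le> 1" and p: "0 < p" and g: "g \<in> space \<mu> \<rightarrow> V" and \<phi>: "\<phi> \<in> dual_ball V N"
  shows "Lp_norm p (completion \<mu>) (\<lambda>w. \<phi> (g w)) \<le> Phi p \<sigma> \<mu> V N g"
proof -
  let ?h = "\<lambda>w. \<bar>\<phi> (g w)\<bar> powr (1 - \<sigma>) * N (g w) powr \<sigma>"
  have "Lp_norm p (completion \<mu>) (\<lambda>w. \<phi> (g w)) \<le> Lp_norm p (completion \<mu>) ?h"
  proof (rule Lp_norm_mono_AE[OF p], rule AE_I2)
    fix w assume "w \<in> space (completion \<mu>)"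
    then have "\<bar>\<phi> (g w)\<bar> \<le> N (g w)"
      using g by (intro dual_ballD(2)[OF \<phi>]) auto
    have "\<bar>\<phi> (g w)\<bar> = \<bar>\<phi> (g w)\<bar> powr (1 - \<sigma>) * \<bar>\<phi> (g w)\<bar> powr \<sigma>"
      by (simp flip: powr_add)
    also have "\<dots> \<le> ?h w"
      using \<open>\<bar>\<phi> (g w)\<bar> \<le> N (g w)\<close> \<sigma> by (intro mult_left_mono powr_mono2) auto
    finally show "\<bar>\<phi> (g w)\<bar> \<le> \<bar>?h w\<bar>" by simp
  qed
  also have "\<dots> \<le> Phi p \<sigma> \<mu> V N g"
    unfolding Phi_def by (rule SUP_upper2[OF \<phi>]) (simp add: Lp_norm_def abs_mult)
  finally show ?thesis .
qed

text \<open>For each decomposition in the infimum and each functional, Minkowski's inequality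
  reduces the claim to a single summand. Equality up to seminorm 0 suffices, since functionals in
  the dual ball do not see such differences.\<close>

lemma pettis_norm_le_sigma_norm:
  assumes \<sigma>: "0 \<le> \<sigma>" "\<sigma> \<le> 1" and p: "1 \<le> p" and s: "s \<in> space \<mu> \<rightarrow> V"
  shows "pettis_norm p \<mu> V N s \<le> sigma_norm p \<sigma> \<mu> V N s"
  unfolding sigma_norm_def pettis_norm_eq_SUP_Lp_norm
proof (rule Inf_greatest, safe, rule SUP_least)
  fix n :: nat and g \<phi>
  assume g: "\<forall>i<n. g i \<in> simple_functions \<mu> V"
    and eq: "AE w in \<mu>. N (s w - (\<Sum>i<n. g i w)) = 0"
    and \<phi>: "\<phi> \<in> dual_ball V N"
  have gV: "g i w \<in> V" if "i < n" "w \<in> space \<mu>" for i w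
    using g that by (intro simple_functionsD(3)[of "g i"]) auto
  have "AE w in completion \<mu>. \<bar>\<phi> (s w)\<bar> = \<bar>\<Sum>i<n. \<phi> (g i w)\<bar>"
    using AE_completion[OF eq] AE_space
  proof eventually_elim
    case (elim w)
    have mem: "s w \<in> V" "(\<Sum>i<n. g i w) \<in> V"
      using s gV elim(2) subspace by (auto intro!: subspace_sum)
    have "\<phi> (s w) = \<phi> (\<Sum>i<n. g i w)"
      using dual_ball_Lipschitz[OF \<phi> mem] elim(1) by simp
    also have "\<dots> = (\<Sum>i<n. \<phi> (g i w))"
      using elim(2) gV by (intro linear_on_sum[OF dual_ballD(1)[OF \<phi>] subspace]) auto
    finally show ?case by simp
  qed
  then have "Lp_norm p (completion \<mu>) (\<lambda>w. \<phi> (s w)) = Lp_norm p (completion \<mu>) (\<lambda>w. \<Sum>i<n. \<phi> (g i w))"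
    by (rule Lp_norm_cong_AE)
  also have "\<dots> \<le> (\<Sum>i<n. Lp_norm p (completion \<mu>) (\<lambda>w. \<phi> (g i w)))"
  proof (rule Lp_norm_sum_le[OF p])
    fix i assume "i \<in> {..<n}"
    with g have "simple_function (completion \<mu>) (g i)"
      by (intro simple_functionsD(2)) auto
    then show "(\<lambda>w. \<phi> (g i w)) \<in> borel_measurable (completion \<mu>)"
      by (rule simple_function_compose_borel_measurable)
  qed simp
  also have "\<dots> \<le> (\<Sum>i<n. Phi p \<sigma> \<mu> V N (g i))"
    using \<sigma> p \<phi> gV by (intro sum_mono Lp_norm_dual_ball_le_Phi) auto
  finally show "Lp_norm p (completion \<mu>) (\<lambda>w. \<phi> (s w)) \<le> (\<Sum>i<n. Phi p \<sigma> \<mu> V N (g i))" .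
qed

lemma pettis_norm_le_add_diff:
  assumes p: "1 \<le> p" and f: "strongly_measurable \<mu> V N f" and s: "strongly_measurable \<mu> V N s"
  shows "pettis_norm p \<mu> V N f \<le> pettis_norm p \<mu> V N (s - f) + pettis_norm p \<mu> V N s"
  unfolding pettis_norm_eq_SUP_Lp_norm[of _ _ _ _ f]
proof (rule SUP_least)
  fix \<phi> assume \<phi>: "\<phi> \<in> dual_ball V N"
  have "Lp_norm p (completion \<mu>) (\<lambda>w. \<phi> (f w))
      \<le> Lp_norm p (completion \<mu>) (\<lambda>w. \<bar>\<phi> ((s - f) w)\<bar> + \<bar>\<phi> (s w)\<bar>)"
  proof (rule Lp_norm_mono_AE, use p in simp, rule AE_I2)
    fix w assume "w \<in> space (completion \<mu>)"
    then have "s w \<in> V" "f w \<in> V"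
      using f s by (auto simp: strongly_measurable_def)
    then have "\<phi> ((s - f) w) = \<phi> (s w) - \<phi> (f w)"
      using linear_on_diff[OF dual_ballD(1)[OF \<phi>] subspace] by simp
    then show "\<bar>\<phi> (f w)\<bar> \<le> \<bar>\<bar>\<phi> ((s - f) w)\<bar> + \<bar>\<phi> (s w)\<bar>\<bar>" by simp
  qed
  also have "\<dots> \<le> Lp_norm p (completion \<mu>) (\<lambda>w. \<bar>\<phi> ((s - f) w)\<bar>) + Lp_norm p (completion \<mu>) (\<lambda>w. \<bar>\<phi> (s w)\<bar>)"
    using borel_measurable_dual_ball_compose[OF strongly_measurable_diff[OF s f] \<phi>]
      borel_measurable_dual_ball_compose[OF s \<phi>] p
    by (intro Lp_norm_add_le borel_measurable_abs)
  also have "\<dots> = Lp_norm p (completion \<mu>) (\<lambda>w. \<phi> ((s - f) w)) + Lp_norm p (completion \<mu>) (\<lambda>w. \<phi> (s w))"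
    by (simp add: Lp_norm_def)
  also have "\<dots> \<le> pettis_norm p \<mu> V N (s - f) + pettis_norm p \<mu> V N s"
    unfolding pettis_norm_eq_SUP_Lp_norm using \<phi> by (intro add_mono SUP_upper)
  finally show "Lp_norm p (completion \<mu>) (\<lambda>w. \<phi> (f w)) \<le> pettis_norm p \<mu> V N (s - f) + pettis_norm p \<mu> V N s" .
qed

text \<open>For an approximating sequence the Pettis norm of \<open>f\<close> is at most that of
  \<open>s n - f\<close> plus the \<sigma>-norm of \<open>s n\<close>; the first term tends to 0 and
  the second to \<open>L\<close>.\<close>

lemma pettis_norm_le_pettis_sigma_norm:
  assumes \<sigma>: "0 \<le> \<sigma>" "\<sigma> \<le> 1" and p: "1 \<le> p" and f: "strongly_measurable \<mu> V N f"
  shows "pettis_norm p \<mu> V N f \<le> pettis_sigma_norm p \<sigma> \<mu> V N f"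
  unfolding pettis_sigma_norm_def
proof (rule Inf_greatest, safe)
  fix L s
  assume s: "sigma_approx p \<sigma> \<mu> V N s f" and L: "(\<lambda>n. sigma_norm p \<sigma> \<mu> V N (s n)) \<longlonglongrightarrow> L"
  have simple: "s n \<in> simple_functions \<mu> V" for n
    using s by (auto simp: sigma_approx_def)
  have "(\<lambda>n. pettis_norm p \<mu> V N (s n - f) + sigma_norm p \<sigma> \<mu> V N (s n)) \<longlonglongrightarrow> 0 + L"
    using s L by (intro tendsto_add) (auto simp: sigma_approx_def)
  moreover have "pettis_norm p \<mu> V N f \<le> pettis_norm p \<mu> V N (s n - f) + sigma_norm p \<sigma> \<mu> V N (s n)" for n
  proof -
    have "pettis_norm p \<mu> V N (s n) \<le> sigma_norm p \<sigma> \<mu> V N (s n)"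
      using \<sigma> p simple_functionsD(3)[OF simple] by (intro pettis_norm_le_sigma_norm) auto
    then show ?thesis
      using pettis_norm_le_add_diff[OF p f strongly_measurable_simple[OF simple]]
      by (meson add_left_mono order_trans)
  qed
  ultimately have "pettis_norm p \<mu> V N f \<le> 0 + L"
    by (intro LIMSEQ_le_const) auto
  then show "pettis_norm p \<mu> V N f \<le> L"
    by simp
qed

lemma pettis_norm_simple_finite:
  assumes \<mu>: "finite_measure \<mu>" and p: "0 < p" and s: "s \<in> simple_functions \<mu> V"
  shows "pettis_norm p \<mu> V N s < \<infinity>"
proof -
  define B where "B = Max (insert 0 (N ` s ` space \<mu>))"
  have fin: "finite (insert 0 (N ` s ` space \<mu>))"
    using simple_functionD(1)[OF simple_functionsD(1)[OF s]] by simp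
  have "0 \<le> B"
    unfolding B_def using fin by (rule Max_ge) simp
  have B: "N (s w) \<le> B" if "w \<in> space \<mu>" for w
    unfolding B_def using fin that by (intro Max_ge) simp_all
  have "pettis_norm p \<mu> V N s \<le> Lp_norm p (completion \<mu>) (\<lambda>_. B)"
    unfolding pettis_norm_eq_SUP_Lp_norm
  proof (rule SUP_least, rule Lp_norm_mono_AE[OF p], rule AE_I2)
    fix \<phi> w assume "\<phi> \<in> dual_ball V N" "w \<in> space (completion \<mu>)"
    then show "\<bar>\<phi> (s w)\<bar> \<le> \<bar>B\<bar>"
      using dual_ballD(2)[of \<phi> "s w"] B[of w] simple_functionsD(3)[OF s, of w] by simp
  qed
  also have "\<dots> < \<infinity>"
    using finite_measure.emeasure_finite[OF \<mu>, of "space \<mu>"] p \<open>0 \<le> B\<close>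
    by (simp add: Lp_norm_const epowr_def ennreal_mult_less_top)
  finally show ?thesis .
qed

text \<open>Membership in \<open>pettis_space\<close> bounds the integrals for each functional
  separately. The bound uniform over the dual ball comes from a simple function at finite Pettis
  distance.\<close>

lemma pettis_norm_finite:
  assumes \<mu>: "finite_measure \<mu>" and p: "1 \<le> p" and f: "f \<in> pettis_sigma_space p \<sigma> \<mu> V N"
  shows "pettis_norm p \<mu> V N f < \<infinity>"
proof -
  obtain s where s: "sigma_approx p \<sigma> \<mu> V N s f"
    using f by (auto simp: pettis_sigma_space_def)
  then have simple: "s n \<in> simple_functions \<mu> V" for n
    by (auto simp: sigma_approx_def)
  have "(\<lambda>n. pettis_norm p \<mu> V N (s n - f)) \<longlonglongrightarrow> 0"
    using s by (simp add: sigma_approx_def)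
  then have "\<forall>\<^sub>F n in sequentially. pettis_norm p \<mu> V N (s n - f) < \<infinity>"
    by (rule order_tendstoD(2)) simp
  then obtain n where n: "pettis_norm p \<mu> V N (s n - f) < \<infinity>"
    by (meson eventually_happens trivial_limit_sequentially)
  have "strongly_measurable \<mu> V N f"
    using f by (auto simp: pettis_sigma_space_def pettis_space_def)
  then have "pettis_norm p \<mu> V N f \<le> pettis_norm p \<mu> V N (s n - f) + pettis_norm p \<mu> V N (s n)"
    using p strongly_measurable_simple[OF simple] by (intro pettis_norm_le_add_diff)
  also have "\<dots> < \<infinity>"
    using n pettis_norm_simple_finite[OF \<mu> _ simple, of p n] p by simp
  finally show ?thesis .
qed

lemma strongly_measurable_compose:
  fixes u :: "'v \<Rightarrow> 'e::real_normed_vector"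
  assumes u: "linear_on V u" "\<And>x. x \<in> V \<Longrightarrow> norm (u x) \<le> C * N x" and f: "strongly_measurable \<mu> V N f"
  shows "strongly_measurable \<mu> UNIV norm (u \<circ> f)"
proof -
  obtain s where s: "\<And>n. s n \<in> simple_functions \<mu> V" "AE w in \<mu>. (\<lambda>n. N (s n w - f w)) \<longlonglongrightarrow> 0"
    and fV: "f \<in> space \<mu> \<rightarrow> V"
    using f unfolding strongly_measurable_def by blast
  have "u \<circ> s n \<in> simple_functions \<mu> UNIV" for n
    using simple_functionsD(1)[OF s(1)] by (simp add: simple_functions_def)
  moreover have "AE w in \<mu>. (\<lambda>n. norm ((u \<circ> s n) w - (u \<circ> f) w)) \<longlonglongrightarrow> 0"
    using s(2) AE_space
  proof eventually_elim
    case (elim w)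
    have le: "norm (norm ((u \<circ> s n) w - (u \<circ> f) w)) \<le> C * N (s n w - f w)" for n
    proof -
      have mem: "s n w \<in> V" "f w \<in> V"
        using simple_functionsD(3)[OF s(1)] fV elim(2) by auto
      then have "u (s n w) - u (f w) = u (s n w - f w)"
        using linear_on_diff[OF u(1) subspace] by simp
      then show ?thesis
        using u(2)[OF subspace_diff[OF subspace mem]] by simp
    qed
    have "(\<lambda>n. C * N (s n w - f w)) \<longlonglongrightarrow> 0"
      using tendsto_mult_left[OF elim(1), of C] by simp
    with always_eventually[OF allI[OF le]] show ?case
      by (rule Lim_null_comparison)
  qed
  ultimately show ?thesis
    unfolding strongly_measurable_def by (intro conjI exI[of _ "\<lambda>n. u \<circ> s n"]) auto
qed

text \<open>The bound of the Bochner norm by \<open>C\<close> times the Pettis norm gives membership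
  when applied to \<open>f\<close>, and continuity when applied to \<open>g - f\<close>.\<close>

lemma p_summing_imp_continuous_compose:
  assumes \<mu>: "finite_measure \<mu>" and q: "1 \<le> q" and \<sigma>: "0 \<le> \<sigma>" "\<sigma> \<le> 1"
    and u: "p_summing q V N u" "linear_on V u"
  shows "\<forall>f\<in>pettis_sigma_space q \<sigma> \<mu> V N. u \<circ> f \<in> bochner_space q \<mu> UNIV norm"
    and "continuous_wrt (pettis_sigma_space q \<sigma> \<mu> V N) (pettis_sigma_norm q \<sigma> \<mu> V N)
      (bochner_norm q \<mu> norm) (\<lambda>f. u \<circ> f)"
proof -
  obtain C where C: "summing_const q V N u C"
    using p_summing_imp_summing_const[OF u(1)] by blast
  then have "0 < C" by (simp add: summing_const_def)
  have meas: "strongly_measurable \<mu> V N f" if "f \<in> pettis_sigma_space q \<sigma> \<mu> V N" for f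
    using that by (auto simp: pettis_sigma_space_def pettis_space_def)
  show "\<forall>f\<in>pettis_sigma_space q \<sigma> \<mu> V N. u \<circ> f \<in> bochner_space q \<mu> UNIV norm"
  proof
    fix f assume f: "f \<in> pettis_sigma_space q \<sigma> \<mu> V N"
    have "bochner_norm q \<mu> norm (u \<circ> f) \<le> ennreal C * pettis_norm q \<mu> V N f"
      using C u(2) q \<mu> meas[OF f] by (rule bochner_norm_compose_le_pettis_norm)
    also have "\<dots> < \<infinity>"
      using pettis_norm_finite[OF \<mu> q f] by (simp add: ennreal_mult_less_top)
    finally have "bochner_norm q \<mu> norm (u \<circ> f) < \<infinity>" .
    moreover have "strongly_measurable \<mu> UNIV norm (u \<circ> f)"
      using q meas[OF f] by (intro strongly_measurable_compose[OF u(2) summing_const_bound[OF C]]) auto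
    ultimately show "u \<circ> f \<in> bochner_space q \<mu> UNIV norm"
      by (simp add: bochner_space_def)
  qed
  show "continuous_wrt (pettis_sigma_space q \<sigma> \<mu> V N) (pettis_sigma_norm q \<sigma> \<mu> V N)
      (bochner_norm q \<mu> norm) (\<lambda>f. u \<circ> f)"
    unfolding continuous_wrt_def
  proof safe
    fix f and e :: ennreal assume f: "f \<in> pettis_sigma_space q \<sigma> \<mu> V N" and e: "0 < e"
    show "\<exists>d>0. \<forall>g\<in>pettis_sigma_space q \<sigma> \<mu> V N.
        pettis_sigma_norm q \<sigma> \<mu> V N (g - f) < d \<longrightarrow> bochner_norm q \<mu> norm ((u \<circ> g) - (u \<circ> f)) < e"
    proof (intro exI conjI ballI impI)
      show "0 < e / ennreal C"
        using e by (simp add: ennreal_zero_less_divide)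
      fix g assume g: "g \<in> pettis_sigma_space q \<sigma> \<mu> V N"
        and less: "pettis_sigma_norm q \<sigma> \<mu> V N (g - f) < e / ennreal C"
      have gf: "strongly_measurable \<mu> V N (g - f)"
        using meas[OF g] meas[OF f] by (rule strongly_measurable_diff)
      \<comment> \<open>Linearity of \<open>u\<close> is available on \<open>V\<close> only, hence
        the equality is claimed just on \<open>space \<mu>\<close>, where \<open>f\<close> and
        \<open>g\<close> take values in \<open>V\<close>.\<close>
      have "((u \<circ> g) - (u \<circ> f)) w = (u \<circ> (g - f)) w" if "w \<in> space \<mu>" for w
      proof -
        have "g w \<in> V" "f w \<in> V"
          using meas[OF f] meas[OF g] that by (auto simp: strongly_measurable_def)
        then show ?thesis
          using linear_on_diff[OF u(2) subspace] by simp
      qed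
      then have "bochner_norm q \<mu> norm ((u \<circ> g) - (u \<circ> f)) = bochner_norm q \<mu> norm (u \<circ> (g - f))"
        unfolding bochner_norm_eq_Lp_norm by (intro Lp_norm_cong_AE AE_I2) simp
      also have "\<dots> \<le> ennreal C * pettis_norm q \<mu> V N (g - f)"
        using C u(2) q \<mu> gf by (rule bochner_norm_compose_le_pettis_norm)
      also have "\<dots> \<le> ennreal C * pettis_sigma_norm q \<sigma> \<mu> V N (g - f)"
        using \<sigma> q gf by (intro mult_left_mono pettis_norm_le_pettis_sigma_norm) auto
      also have "\<dots> < ennreal C * (e / ennreal C)"
        using less \<open>0 < C\<close> by (intro ennreal_mult_strict_left_mono) auto
      also have "\<dots> = e"
        using \<open>0 < C\<close> by (simp add: ennreal_times_divide mult_divide_eq_ennreal mult.commute)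
      finally show "bochner_norm q \<mu> norm ((u \<circ> g) - (u \<circ> f)) < e" .
    qed
  qed
qed

end

section \<open>Continuity of the composition operator on simple functions\<close>

text \<open>By induction, cutting one piece in two at each step. The partition into
  \<open>n + 1\<close> pieces is encoded by a label function, so that a test function with
  prescribed values is a composition with \<open>k\<close>.\<close>

lemma non_atomic_partition:
  assumes "non_atomic \<mu>" "0 < emeasure \<mu> (space \<mu>)"
  shows "\<exists>k. simple_function \<mu> k \<and> k \<in> space \<mu> \<rightarrow> {..n::nat}
    \<and> (\<forall>i\<le>n. 0 < emeasure \<mu> (k -` {i} \<inter> space \<mu>))"
proof (induction n)
  case 0
  have "(\<lambda>_. 0) -` {0::nat} \<inter> space \<mu> = space \<mu>" by auto
  with assms(2) show ?case by (intro exI[of _ "\<lambda>_. 0"]) simp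
next
  case (Suc n)
  then obtain k where k: "simple_function \<mu> k" "k \<in> space \<mu> \<rightarrow> {..n}"
    "\<forall>i\<le>n. 0 < emeasure \<mu> (k -` {i} \<inter> space \<mu>)"
    by (elim exE conjE)
  \<comment> \<open>The piece with the last label is the one that is cut; its part \<open>B\<close>
    receives the new label.\<close>
  define A where "A = k -` {n} \<inter> space \<mu>"
  have A: "A \<in> sets \<mu>" "0 < emeasure \<mu> A"
    using k simple_functionD(2)[OF k(1)] by (auto simp: A_def)
  then obtain B where B: "B \<in> sets \<mu>" "B \<subseteq> A" "0 < emeasure \<mu> B" "emeasure \<mu> B < emeasure \<mu> A"
    using assms(1) unfolding non_atomic_def by metis
  define k' where "k' w = (if w \<in> B then Suc n else k w)" for w
  have Bsp: "B \<subseteq> space \<mu>" using B(2) by (auto simp: A_def)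
  have "simple_function \<mu> k'"
    unfolding k'_def[abs_def] using k(1) B(1) by (intro simple_function_If_set) auto
  moreover have "k' \<in> space \<mu> \<rightarrow> {..Suc n}"
    using k(2) by (auto simp: k'_def Pi_iff le_SucI)
  moreover have "0 < emeasure \<mu> (k' -` {i} \<inter> space \<mu>)" if i: "i \<le> Suc n" for i
  proof -
    consider "i < n" | "i = n" | "i = Suc n" using i by linarith
    then show ?thesis
    proof cases
      case 1
      then have "k' -` {i} \<inter> space \<mu> = k -` {i} \<inter> space \<mu>"
        using B(2) by (auto simp: k'_def A_def)
      with 1 k(3) show ?thesis by simp
    next
      case 2
      have "w \<in> k' -` {i} \<inter> space \<mu> \<longleftrightarrow> w \<in> A - B" for w
        using 2 by (cases "w \<in> B") (simp_all add: k'_def A_def)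
      then have "k' -` {i} \<inter> space \<mu> = A - B"
        by (rule set_eqI)
      \<comment> \<open>Being strictly smaller than another measure, the measure of \<open>B\<close>
        is finite, so the subtraction is exact and the remainder has positive measure.\<close>
      moreover have "emeasure \<mu> (A - B) = emeasure \<mu> A - emeasure \<mu> B"
        using A(1) B(1,2) less_le_trans[OF B(4) top_greatest]
        by (intro emeasure_Diff) (simp_all add: less_top)
      ultimately show ?thesis
        using B(4) by (simp add: diff_gr0_ennreal)
    next
      case 3
      have "w \<in> k' -` {i} \<inter> space \<mu> \<longleftrightarrow> w \<in> B" for w
        using 3 subsetD[OF Bsp, of w] funcset_mem[OF k(2), of w] by (cases "w \<in> B") (auto simp: k'_def)
      then have "k' -` {i} \<inter> space \<mu> = B"
        by (rule set_eqI)
      with B(3) show ?thesis by simp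
    qed
  qed
  ultimately show ?case by (intro exI[of _ k'] conjI allI impI)
qed

section \<open>Simple functions as test functions for continuity\<close>

context seminorm_on
begin

lemma simple_functions_pettis_integrable:
  assumes \<mu>: "finite_measure \<mu>" and s: "s \<in> simple_functions \<mu> V"
  shows "pettis_integrable \<mu> V N s"
  unfolding pettis_integrable_def
proof (intro conjI ballI)
  let ?M = "completion \<mu>"
  interpret M: finite_measure ?M
    using finite_measure.emeasure_finite[OF \<mu>] by (intro finite_measureI) simp
  note simple = simple_functionsD(2)[OF s]
  have level: "s -` {y} \<inter> space ?M \<in> sets ?M" for y
    by (rule simple_functionD(2)[OF simple])
  have fin: "finite (s ` space ?M)"
    by (rule simple_functionD(1)[OF simple])
  show "integrable ?M (\<lambda>w. \<phi> (s w))" for \<phi> :: "'v \<Rightarrow> real"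
  proof (rule M.integrable_const_bound)
    show "AE w in ?M. norm (\<phi> (s w)) \<le> Max (norm ` \<phi> ` s ` space ?M)"
      using fin by (intro AE_I2 Max_ge) auto
    show "(\<lambda>w. \<phi> (s w)) \<in> borel_measurable ?M"
      using simple by (rule simple_function_compose_borel_measurable)
  qed
  fix A assume A: "A \<in> sets \<mu>"
  \<comment> \<open>The Pettis integral over \<open>A\<close>: each value is weighted by the measure
    of the part of its level set in \<open>A\<close>.\<close>
  define x where "x = (\<Sum>y\<in>s ` space ?M. measure ?M (A \<inter> (s -` {y} \<inter> space ?M)) *\<^sub>R y)"
  have yV: "y \<in> V" if "y \<in> s ` space ?M" for y
    using that simple_functionsD(3)[OF s] by auto
  show "\<exists>x\<in>V. \<forall>\<phi>\<in>dual_space V N. \<phi> x = (LINT w:A|?M. \<phi> (s w))"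
  proof (intro bexI ballI)
    show "x \<in> V"
      unfolding x_def using yV subspace by (intro subspace_sum subspace_scale) auto
    fix \<phi> assume "\<phi> \<in> dual_space V N"
    then have lin: "linear_on V \<phi>" by (simp add: dual_space_def)
    have "\<phi> x = (\<Sum>y\<in>s ` space ?M. \<phi> (measure ?M (A \<inter> (s -` {y} \<inter> space ?M)) *\<^sub>R y))"
      unfolding x_def using yV subspace by (intro linear_on_sum[OF lin subspace fin] subspace_scale) auto
    also have "\<dots> = (\<Sum>y\<in>s ` space ?M. measure ?M (A \<inter> (s -` {y} \<inter> space ?M)) * \<phi> y)"
      using lin yV by (intro sum.cong) (auto simp: linear_on_def)
    also have "\<dots> = (\<Sum>y\<in>s ` space ?M. LINT w|?M. \<phi> y * indicator (A \<inter> (s -` {y} \<inter> space ?M)) w)"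
      using sets.Int[OF sets_completionI_sets[OF A] level]
      by (intro sum.cong) (auto simp: mult.commute Int_assoc)
    also have "\<dots> = (LINT w|?M. (\<Sum>y\<in>s ` space ?M. \<phi> y * indicator (A \<inter> (s -` {y} \<inter> space ?M)) w))"
      using integrable_real_indicator[OF sets.Int[OF sets_completionI_sets[OF A] level]
          M.emeasure_finite[unfolded infinity_ennreal_def less_top, folded infinity_ennreal_def]]
      by (intro Bochner_Integration.integral_sum[symmetric] integrable_mult_right)
    also have "\<dots> = (LINT w|?M. indicator A w *\<^sub>R \<phi> (s w))"
    proof (rule Bochner_Integration.integral_cong[OF refl])
      fix w assume w: "w \<in> space ?M"
      have "(\<Sum>y\<in>s ` space ?M. \<phi> y * indicator (A \<inter> (s -` {y} \<inter> space ?M)) w)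
          = (\<Sum>y\<in>s ` space ?M. if y = s w then indicator A w * \<phi> y else 0)"
        using w by (intro sum.cong) (auto simp: indicator_def)
      then show "(\<Sum>y\<in>s ` space ?M. \<phi> y * indicator (A \<inter> (s -` {y} \<inter> space ?M)) w) = indicator A w *\<^sub>R \<phi> (s w)"
        using w fin by (simp add: sum.delta)
    qed
    finally show "\<phi> x = (LINT w:A|?M. \<phi> (s w))"
      by (simp add: set_lebesgue_integral_def)
  qed
qed

lemma sigma_norm_zero:
  "sigma_norm p \<sigma> \<mu> V N (\<lambda>_. 0) = 0"
proof -
  have "sigma_norm p \<sigma> \<mu> V N (\<lambda>_. 0) \<le> 0"
    unfolding sigma_norm_def by (rule Inf_lower) (auto simp: N_zero intro!: exI[of _ "0::nat"])
  then show ?thesis by simp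
qed

lemma pettis_norm_zero:
  assumes "0 < p"
  shows "pettis_norm p \<mu> V N (\<lambda>_. 0) = 0"
proof -
  have "pettis_norm p \<mu> V N (\<lambda>_. 0) \<le> 0"
    unfolding pettis_norm_def
  proof (rule SUP_least)
    fix \<phi> assume "\<phi> \<in> dual_ball V N"
    then have "\<phi> 0 = 0"
      using linear_on_zero[OF dual_ballD(1) subspace] by simp
    then show "epowr (\<integral>\<^sup>+ w. ennreal (\<bar>\<phi> 0\<bar> powr p) \<partial>completion \<mu>) (1 / p) \<le> 0"
      using assms by (simp add: epowr_def)
  qed
  then show ?thesis by simp
qed

lemma sigma_approx_const:
  assumes "0 < p" "s \<in> simple_functions \<mu> V"
  shows "sigma_approx p \<sigma> \<mu> V N (\<lambda>_. s) s"
proof -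
  have "s - s = (\<lambda>_. 0)" by auto
  with assms sigma_norm_zero[of p \<sigma> \<mu>] pettis_norm_zero[of p \<mu>] show ?thesis
    by (simp add: sigma_approx_def)
qed

text \<open>Finitely many values on a finite measure space make all scalar integrals finite, and the
  constant sequence is an admissible approximation.\<close>

lemma simple_functions_in_pettis_sigma_space:
  assumes \<mu>: "finite_measure \<mu>" and p: "0 < p" and s: "s \<in> simple_functions \<mu> V"
  shows "s \<in> pettis_sigma_space p \<sigma> \<mu> V N"
proof -
  let ?M = "completion \<mu>"
  interpret M: finite_measure ?M
    using finite_measure.emeasure_finite[OF \<mu>] by (intro finite_measureI) simp
  note simple = simple_functionsD(2)[OF s]
  have fin: "finite (s ` space ?M)"
    by (rule simple_functionD(1)[OF simple])
  have "integrable ?M (\<lambda>w. \<bar>\<phi> (s w)\<bar> powr p)" for \<phi> :: "'v \<Rightarrow> real"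
  proof (rule M.integrable_const_bound)
    show "AE w in ?M. norm (\<bar>\<phi> (s w)\<bar> powr p) \<le> Max ((\<lambda>y. \<bar>\<phi> y\<bar> powr p) ` s ` space ?M)"
      using fin by (intro AE_I2) (simp add: Max_ge)
    show "(\<lambda>w. \<bar>\<phi> (s w)\<bar> powr p) \<in> borel_measurable ?M"
      using simple by (rule simple_function_compose_borel_measurable[where g = "\<lambda>y. \<bar>\<phi> y\<bar> powr p"])
  qed
  then show ?thesis
    using strongly_measurable_simple[OF s] simple_functions_pettis_integrable[OF \<mu> s] sigma_approx_const[OF p s]
    by (auto simp: pettis_sigma_space_def pettis_space_def)
qed

text \<open>The constant sequence \<open>s\<close> competes in the outer infimum and the
  decomposition into the single summand \<open>s\<close> in the inner one.\<close>

lemma pettis_sigma_norm_simple_le_Phi: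
  assumes p: "0 < p" and s: "s \<in> simple_functions \<mu> V"
  shows "pettis_sigma_norm p \<sigma> \<mu> V N s \<le> Phi p \<sigma> \<mu> V N s"
proof -
  have "pettis_sigma_norm p \<sigma> \<mu> V N s \<le> sigma_norm p \<sigma> \<mu> V N s"
    unfolding pettis_sigma_norm_def
    using sigma_approx_const[OF p s] by (intro Inf_lower CollectI exI[of _ "\<lambda>_. s"] conjI tendsto_const)
  also have "\<dots> \<le> Phi p \<sigma> \<mu> V N s"
    unfolding sigma_norm_def using s
    by (intro Inf_lower) (auto simp: N_zero intro!: exI[of _ "1::nat"] exI[of _ "\<lambda>_. s"])
  finally show ?thesis .
qed

text \<open>
  The vectors are placed on disjoint sets of positive measure, rescaled so that the measures
  of the sets drop out.
\<close>

lemma continuous_compose_imp_sum_bound: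
  fixes u :: "'v \<Rightarrow> 'e::real_normed_vector"
  assumes \<mu>: "finite_measure \<mu>" "non_atomic \<mu>" "0 < emeasure \<mu> (space \<mu>)"
    and q: "1 \<le> q" and \<sigma>: "\<sigma> = 1 - 1 / q" and u: "linear_on V u"
    and cont: "continuous_wrt (pettis_sigma_space q \<sigma> \<mu> V N) (pettis_sigma_norm q \<sigma> \<mu> V N)
      (bochner_norm q \<mu> norm) (\<lambda>f. u \<circ> f)"
  shows "\<exists>K>0. \<forall>(n::nat) x B. (\<forall>i<n. x i \<in> V) \<longrightarrow> 0 \<le> B \<longrightarrow>
    (\<forall>\<phi>\<in>dual_ball V N. (\<Sum>i<n. \<bar>\<phi> (x i)\<bar> * N (x i) powr (q - 1)) \<le> B) \<longrightarrow>
    (\<Sum>i<n. norm (u (x i)) powr q) \<le> K * B"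
proof -
  let ?M = "completion \<mu>"
  interpret M: finite_measure ?M
    using finite_measure.emeasure_finite[OF \<mu>(1)] by (intro finite_measureI) simp
  have q0: "0 < q" using q by simp
  have zero: "(\<lambda>_. 0) \<in> simple_functions \<mu> V"
    using subspace by (auto simp: simple_functions_def subspace_0)
  \<comment> \<open>Continuity is used at the zero function with tolerance 1.\<close>
  obtain d where d: "0 < d" "\<And>g. g \<in> pettis_sigma_space q \<sigma> \<mu> V N \<Longrightarrow>
      pettis_sigma_norm q \<sigma> \<mu> V N (g - (\<lambda>_. 0)) < d \<Longrightarrow> bochner_norm q \<mu> norm ((u \<circ> g) - (u \<circ> (\<lambda>_. 0))) < 1"
    using cont simple_functions_in_pettis_sigma_space[OF \<mu>(1) q0 zero]
    unfolding continuous_wrt_def by (metis zero_less_one)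
  \<comment> \<open>The radius \<open>d\<close> may be infinite; a value strictly below it is finite
    and yields a real radius \<open>r\<close>.\<close>
  obtain z where z: "0 < z" "z < d" using dense[OF d(1)] by blast
  define r where "r = enn2real z"
  have r: "0 < r" "ennreal r < d"
    using z less_le_trans[OF z(2) top_greatest] by (auto simp: r_def enn2real_positive_iff)
  \<comment> \<open>The family is nonempty because a partition has at least one piece, and
    \<open>B'\<close> is positive because it is divided by.\<close>
  have *: "(\<Sum>i<n. norm (u (x i)) powr q) \<le> 1 / r powr q * B'"
    if x: "\<forall>i<n. x i \<in> V" and n: "n = Suc m" and B': "0 < B'"
      and B: "\<And>\<phi>. \<phi> \<in> dual_ball V N \<Longrightarrow> (\<Sum>i<n. \<bar>\<phi> (x i)\<bar> * N (x i) powr (q - 1)) \<le> B'"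
    for n m :: nat and x B'
  proof -
    obtain k where k: "simple_function \<mu> k" "k \<in> space \<mu> \<rightarrow> {..m}"
      "\<forall>i\<le>m. 0 < emeasure \<mu> (k -` {i} \<inter> space \<mu>)"
      using non_atomic_partition[OF \<mu>(2,3), of m] by (elim exE conjE)
    have im: "k ` space ?M = {..<n}"
    proof
      show "k ` space ?M \<subseteq> {..<n}" using k(2) n by (auto simp: Pi_iff less_Suc_eq_le)
      show "{..<n} \<subseteq> k ` space ?M"
      proof
        fix i assume "i \<in> {..<n}"
        then have "k -` {i} \<inter> space \<mu> \<noteq> {}"
          using k(3) n by (metis emeasure_empty lessThan_iff less_Suc_eq_le less_irrefl)
        then show "i \<in> k ` space ?M" by auto
      qed
    qed
    define c where "c i = measure ?M (k -` {i} \<inter> space ?M)" for i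
    have c: "emeasure ?M (k -` {i} \<inter> space ?M) = ennreal (c i)" for i
      by (simp add: c_def M.emeasure_eq_measure del: emeasure_completion)
    have c0: "0 < c i" if "i < n" for i
    proof -
      have "0 < emeasure ?M (k -` {i} \<inter> space ?M)"
        using k(3) that n simple_functionD(2)[OF k(1)] by simp
      then show ?thesis unfolding c by simp
    qed
    have int: "(\<integral>\<^sup>+ w. ennreal (h (k w)) \<partial>?M) = ennreal (\<Sum>i<n. h i * c i)" if "\<And>i. 0 \<le> h i" for h
    proof -
      have "(\<integral>\<^sup>+ w. ennreal (h (k w)) \<partial>?M) = (\<Sum>i<n. ennreal (h i) * ennreal (c i))"
        using nn_integral_simple_function_compose[OF simple_function_completion[OF k(1)], of "\<lambda>i. ennreal (h i)"]
        unfolding im c .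
      also have "\<dots> = ennreal (\<Sum>i<n. h i * c i)"
        using that by (subst sum_ennreal[symmetric]) (auto simp: ennreal_mult c_def)
      finally show ?thesis .
    qed
    \<comment> \<open>Chosen so that \<open>s powr q * B'\<close> equals \<open>r powr q\<close>,
      which brings \<open>Phi\<close> of the test function down to \<open>r\<close>.\<close>
    define s where "s = r / B' powr (1 / q)"
    have s: "0 < s" "s powr q = r powr q / B'"
      using r B' q0 by (auto simp: s_def powr_divide powr_powr)
    define a where "a i = s * c i powr (- 1 / q)" for i
    have a: "0 < a i" "a i powr q * c i = s powr q" if "i < n" for i
      using s c0[OF that] q0 by (auto simp: a_def powr_mult powr_powr powr_minus_divide powr_divide)
    define Y where "Y i = (if i < n then a i *\<^sub>R x i else 0)" for i
    have YV: "Y i \<in> V" for i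
      using x subspace by (auto simp: Y_def intro: subspace_scale subspace_0)
    define g where "g = Y \<circ> k"
    have g: "g \<in> simple_functions \<mu> V"
      using k(1) YV by (auto simp: simple_functions_def g_def)
    have "Phi q \<sigma> \<mu> V N g \<le> ennreal r"
      unfolding Phi_def
    proof (rule SUP_least)
      fix \<phi> assume \<phi>: "\<phi> \<in> dual_ball V N"
      let ?h = "\<lambda>i. (\<bar>\<phi> (Y i)\<bar> powr (1 - \<sigma>) * N (Y i) powr \<sigma>) powr q"
      have "?h i * c i = s powr q * (\<bar>\<phi> (x i)\<bar> * N (x i) powr (q - 1))" if i: "i < n" for i
      proof -
        \<comment> \<open>The choice of \<sigma> makes the functional enter with exponent 1 and the
          seminorm with exponent \<open>q - 1\<close>.\<close>
        have "\<sigma> * q = q - 1" "(1 - \<sigma>) * q = 1"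
          using q0 by (simp_all add: \<sigma> field_simps)
        then have "?h i = \<bar>\<phi> (Y i)\<bar> * N (Y i) powr (q - 1)"
          by (simp add: powr_mult powr_powr)
        also have "\<dots> = \<bar>a i * \<phi> (x i)\<bar> * (a i * N (x i)) powr (q - 1)"
          using dual_ballD(1)[OF \<phi>] x i a(1)[OF i] by (simp add: Y_def linear_on_def scale)
        also have "\<bar>a i * \<phi> (x i)\<bar> * (a i * N (x i)) powr (q - 1)
            = (a i powr 1 * a i powr (q - 1)) * (\<bar>\<phi> (x i)\<bar> * N (x i) powr (q - 1))"
          using a(1)[OF i] by (simp add: abs_mult powr_mult)
        also have "a i powr 1 * a i powr (q - 1) = a i powr q"
          using powr_add[of "a i" 1 "q - 1"] by simp
        finally show ?thesis
          using a(2)[OF i] by (simp add: mult.commute mult.left_commute)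
      qed
      then have "(\<Sum>i<n. ?h i * c i) = s powr q * (\<Sum>i<n. \<bar>\<phi> (x i)\<bar> * N (x i) powr (q - 1))"
        by (simp add: sum_distrib_left)
      also have "\<dots> \<le> s powr q * B'"
        using B[OF \<phi>] by (intro mult_left_mono) auto
      also have "\<dots> = r powr q"
        using s B' by simp
      finally have "(\<integral>\<^sup>+ w. ennreal (?h (k w)) \<partial>?M) \<le> ennreal (r powr q)"
        by (subst int) (auto intro: ennreal_leI)
      then show "epowr (\<integral>\<^sup>+ w. ennreal ((\<bar>\<phi> (g w)\<bar> powr (1 - \<sigma>) * N (g w) powr \<sigma>) powr q) \<partial>?M) (1 / q) \<le> ennreal r"
        using q0 r by (simp add: epowr_le_ennreal_iff g_def)
    qed
    with pettis_sigma_norm_simple_le_Phi[OF q0 g] r(2) have "pettis_sigma_norm q \<sigma> \<mu> V N g < d"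
      by (meson le_less_trans order_trans)
    moreover have "g - (\<lambda>_. 0) = g" by auto
    ultimately have "bochner_norm q \<mu> norm ((u \<circ> g) - (u \<circ> (\<lambda>_. 0))) < 1"
      using d(2)[OF simple_functions_in_pettis_sigma_space[OF \<mu>(1) q0 g]] by simp
    moreover have "(u \<circ> g) - (u \<circ> (\<lambda>_. 0)) = u \<circ> g"
      using linear_on_zero[OF u subspace] by auto
    ultimately have "bochner_norm q \<mu> norm (u \<circ> g) \<le> ennreal 1"
      by (simp add: less_imp_le)
    then have "(\<integral>\<^sup>+ w. ennreal (norm (u (Y (k w))) powr q) \<partial>?M) \<le> ennreal 1"
      using q0 unfolding bochner_norm_def by (subst (asm) epowr_le_ennreal_iff) (simp_all add: g_def)
    then have le1: "(\<Sum>i<n. norm (u (Y i)) powr q * c i) \<le> 1"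
      by (subst (asm) int) (simp_all add: sum_nonneg)
    have "(\<Sum>i<n. norm (u (Y i)) powr q * c i) = (\<Sum>i<n. s powr q * norm (u (x i)) powr q)"
    proof (intro sum.cong refl)
      fix i assume "i \<in> {..<n}"
      then have i: "i < n" by simp
      have "norm (u (Y i)) = a i * norm (u (x i))"
        using u x i a(1)[OF i] by (simp add: Y_def linear_on_def)
      then show "norm (u (Y i)) powr q * c i = s powr q * norm (u (x i)) powr q"
        using a(2)[OF i] by (simp add: powr_mult mult_ac)
    qed
    then have "s powr q * (\<Sum>i<n. norm (u (x i)) powr q) \<le> 1"
      using le1 by (simp add: sum_distrib_left)
    then show ?thesis
      using s r B' by (simp add: field_simps)
  qed
  show ?thesis
  proof (intro exI[of _ "1 / r powr q"] conjI allI impI)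
    show "0 < 1 / r powr q" using r by simp
    fix n :: nat and x B
    assume x: "\<forall>i<n. x i \<in> V" and B0: "0 \<le> B"
      and B: "\<forall>\<phi>\<in>dual_ball V N. (\<Sum>i<n. \<bar>\<phi> (x i)\<bar> * N (x i) powr (q - 1)) \<le> B"
    show "(\<Sum>i<n. norm (u (x i)) powr q) \<le> 1 / r powr q * B"
    proof (cases n)
      case 0
      with B0 show ?thesis by simp
    next
      case (Suc m)
      show ?thesis
      \<comment> \<open>Since \<open>B\<close> may be 0, the estimate is applied to
        \<open>B + e * r powr q\<close>; division by \<open>r powr q\<close> leaves the error
        \<open>e\<close>.\<close>
      proof (rule field_le_epsilon)
        fix e :: real assume e: "0 < e"
        have "(\<Sum>i<n. norm (u (x i)) powr q) \<le> 1 / r powr q * (B + e * r powr q)"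
          using e r B0 B by (intro *[OF x Suc]) (auto intro: add_nonneg_pos order_trans)
        also have "\<dots> = 1 / r powr q * B + e"
          using r by (simp add: field_simps)
        finally show "(\<Sum>i<n. norm (u (x i)) powr q) \<le> 1 / r powr q * B + e" .
      qed
    qed
  qed
qed

end

section \<open>Functionals and truncations on \<open>L\<^sup>\<infinity>\<close>\<close>

text \<open>Zorn's lemma yields a minimal proper filter below \<open>F\<close>. The infimum of a
  chain is proper because each nonempty finite part of the chain has a least member. Minimality
  decides every \<open>P\<close>: restricting \<open>U\<close> to \<open>P\<close> gives either
  \<open>bot\<close> or \<open>U\<close> itself.\<close>

lemma ex_ultrafilter:
  fixes F :: "'a filter"
  assumes "F \<noteq> bot"
  shows "\<exists>U\<le>F. U \<noteq> bot \<and> (\<forall>P. eventually P U \<or> eventually (\<lambda>x. \<not> P x) U)"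
proof -
  define \<A> where "\<A> = {U. U \<noteq> bot \<and> U \<le> F}"
  have "\<exists>U\<in>\<A>. \<forall>G\<in>\<A>. U \<ge> G \<longrightarrow> G = U"
  proof (rule predicate_Zorn)
    show "partial_order_on \<A> (relation_of (\<ge>) \<A>)"
      by (rule partial_order_on_relation_ofI) auto
    fix C assume C: "C \<in> Chains (relation_of (\<ge>) \<A>)"
    then have CA: "C \<subseteq> \<A>"
      by (rule Chains_relation_of)
    have chain: "G \<le> H \<or> H \<le> G" if "G \<in> C" "H \<in> C" for G H
      using C that by (auto simp: Chains_def relation_of_def)
    show "\<exists>U\<in>\<A>. \<forall>G\<in>C. G \<ge> U"
    proof (cases "C = {}")
      case True
      with assms show ?thesis by (auto simp: \<A>_def)
    next
      case False
      have "Inf X \<noteq> bot" if X: "X \<subseteq> C" "finite X" for X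
      proof (cases "X = {}")
        case True
        from assms have "(top :: 'a filter) \<noteq> bot"
          using top_greatest[of F] by (metis bot_unique)
        with True show ?thesis by simp
      next
        case ne: False
        have "\<exists>G\<in>X. \<forall>H\<in>X. G \<le> H"
          using X(2) ne X(1)
        proof (induction rule: finite_ne_induct)
          case (insert x X)
          then obtain G where G: "G \<in> X" "\<forall>H\<in>X. G \<le> H" by auto
          then show ?case
            using chain[of x G] insert.prems by (auto intro: order_trans)
        qed auto
        then obtain G where G: "G \<in> X" "\<forall>H\<in>X. G \<le> H" by blast
        then have "G \<le> Inf X" by (intro Inf_greatest) auto
        with G X CA show ?thesis by (auto simp: \<A>_def bot_unique)
      qed
      then have "Inf C \<noteq> bot" by (rule Inf_filter_not_bot)
      moreover have "Inf C \<le> F"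
        using False CA by (auto simp: \<A>_def intro: Inf_lower2)
      ultimately show ?thesis
        by (intro bexI[of _ "Inf C"]) (auto simp: \<A>_def Inf_lower)
    qed
  qed
  then obtain U where U: "U \<noteq> bot" "U \<le> F"
    and max: "\<And>G. G \<noteq> bot \<Longrightarrow> G \<le> U \<Longrightarrow> G = U"
    unfolding \<A>_def by (auto intro: order_trans)
  have "eventually P U \<or> eventually (\<lambda>x. \<not> P x) U" for P
  proof (cases "inf U (principal {x. P x}) = bot")
    case True
    then have "eventually (\<lambda>_. False) (inf U (principal {x. P x}))" by simp
    then show ?thesis
      by (simp add: eventually_inf_principal)
  next
    case False
    then have "inf U (principal {x. P x}) = U" by (intro max) auto
    then have "U \<le> principal {x. P x}" by (metis inf.cobounded2)
    then show ?thesis by (simp add: le_principal)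
  qed
  with U show ?thesis by blast
qed

text \<open>Compactness of the interval from \<open>-c\<close> to \<open>c\<close> provides a
  cluster point, and an ultrafilter converges to each of its cluster points, since otherwise it
  would eventually avoid a neighbourhood.\<close>

lemma ultrafilter_tendsto_bounded:
  fixes g :: "'a \<Rightarrow> real"
  assumes U: "U \<noteq> bot" "\<And>P. eventually P U \<or> eventually (\<lambda>x. \<not> P x) U"
    and g: "eventually (\<lambda>x. \<bar>g x\<bar> \<le> c) U"
  shows "\<exists>l. (g \<longlongrightarrow> l) U"
proof -
  have "filtermap g U \<noteq> bot"
    using U(1) by (simp add: filtermap_bot_iff)
  moreover have "eventually (\<lambda>y. y \<in> {-c..c}) (filtermap g U)"
    using g by (auto simp: eventually_filtermap elim: eventually_mono)
  ultimately obtain l where l: "inf (nhds l) (filtermap g U) \<noteq> bot"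
    using compact_Icc[of "-c" c] unfolding compact_filter by blast
  have "eventually (\<lambda>x. g x \<in> S) U" if S: "open S" "l \<in> S" for S
  proof (rule ccontr)
    assume "\<not> eventually (\<lambda>x. g x \<in> S) U"
    then have "eventually (\<lambda>y. y \<notin> S) (filtermap g U)"
      using U(2)[of "\<lambda>x. g x \<in> S"] by (simp add: eventually_filtermap)
    moreover have "eventually (\<lambda>y. y \<in> S) (nhds l)"
      using S by (rule eventually_nhds_in_open)
    ultimately have "eventually (\<lambda>_. False) (inf (nhds l) (filtermap g U))"
      unfolding eventually_inf by (intro exI[of _ "\<lambda>y. y \<in> S"] exI[of _ "\<lambda>y. y \<notin> S"]) simp
    with l show False by (simp add: trivial_limit_def)
  qed
  then show ?thesis by (auto simp: tendsto_def)
qed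

section \<open>The essential supremum seminorm\<close>

lemma LinfI:
  assumes "g \<in> borel_measurable \<nu>" "AE x in \<nu>. \<bar>g x\<bar> \<le> c"
  shows "g \<in> Linf \<nu>"
proof -
  have "esssup \<nu> (\<lambda>x. ereal \<bar>g x\<bar>) \<le> ereal c"
    using assms by (intro esssup_I) auto
  also have "\<dots> < \<infinity>" by simp
  finally show ?thesis using assms by (simp add: Linf_def)
qed

lemma Linf_norm_le:
  assumes "g \<in> borel_measurable \<nu>" "AE x in \<nu>. \<bar>g x\<bar> \<le> c" "0 \<le> c"
  shows "Linf_norm \<nu> g \<le> c"
proof -
  have "esssup \<nu> (\<lambda>x. ereal \<bar>g x\<bar>) \<le> ereal c"
    using assms by (intro esssup_I) auto
  with assms(3) show ?thesis
    unfolding Linf_norm_def by (cases "esssup \<nu> (\<lambda>x. ereal \<bar>g x\<bar>)") auto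
qed

lemma AE_Linf_norm:
  assumes "g \<in> Linf \<nu>"
  shows "AE x in \<nu>. \<bar>g x\<bar> \<le> Linf_norm \<nu> g"
proof -
  have "AE x in \<nu>. ereal \<bar>g x\<bar> \<le> esssup \<nu> (\<lambda>x. ereal \<bar>g x\<bar>)"
    by (rule esssup_AE)
  moreover have "esssup \<nu> (\<lambda>x. ereal \<bar>g x\<bar>) < \<infinity>"
    using assms by (simp add: Linf_def)
  ultimately show ?thesis
    unfolding Linf_norm_def by (cases "esssup \<nu> (\<lambda>x. ereal \<bar>g x\<bar>)") auto
qed

lemma Linf_norm_nonneg:
  assumes "g \<in> Linf \<nu>"
  shows "0 \<le> Linf_norm \<nu> g"
proof (cases "0 \<le> esssup \<nu> (\<lambda>x. ereal \<bar>g x\<bar>)")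
  case True
  then show ?thesis by (simp add: Linf_norm_def real_of_ereal_pos)
next
  \<comment> \<open>A negative essential supremum of \<bar>g\<bar> makes a contradictory inequality
    hold almost everywhere. Hence it is -\<infinity>, which \<open>real_of_ereal\<close> sends to
    0.\<close>
  case False
  have "AE x in \<nu>. ereal \<bar>g x\<bar> \<le> esssup \<nu> (\<lambda>x. ereal \<bar>g x\<bar>)"
    by (rule esssup_AE)
  then have "AE x in \<nu>. ereal \<bar>g x\<bar> \<le> -\<infinity>"
  proof (rule eventually_mono)
    fix x assume "ereal \<bar>g x\<bar> \<le> esssup \<nu> (\<lambda>x. ereal \<bar>g x\<bar>)"
    with False show "ereal \<bar>g x\<bar> \<le> -\<infinity>"
      by (meson abs_ge_zero ereal_less_eq(5) order_trans)
  qed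
  then have "esssup \<nu> (\<lambda>x. ereal \<bar>g x\<bar>) \<le> -\<infinity>"
    using assms by (intro esssup_I) (auto simp: Linf_def)
  then show ?thesis by (simp add: Linf_norm_def)
qed

lemma borel_measurable_Linf: "g \<in> Linf \<nu> \<Longrightarrow> g \<in> borel_measurable \<nu>"
  by (simp add: Linf_def)

lemma AE_add_le_Linf_norm:
  assumes "g \<in> Linf \<nu>" "h \<in> Linf \<nu>"
  shows "AE x in \<nu>. \<bar>(g + h) x\<bar> \<le> Linf_norm \<nu> g + Linf_norm \<nu> h"
  using AE_Linf_norm[OF assms(1)] AE_Linf_norm[OF assms(2)] by eventually_elim auto

lemma AE_scale_le_Linf_norm:
  assumes "g \<in> Linf \<nu>"
  shows "AE x in \<nu>. \<bar>(c *\<^sub>R g) x\<bar> \<le> \<bar>c\<bar> * Linf_norm \<nu> g"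
  using AE_Linf_norm[OF assms]
  by eventually_elim (auto simp: scaleR_fun_def abs_mult intro: mult_left_mono)

lemma subspace_Linf: "subspace (Linf \<nu>)"
proof (rule subspaceI)
  show "0 \<in> Linf \<nu>"
    by (rule LinfI[of _ _ 0]) (simp_all add: zero_fun_def)
  show "g + h \<in> Linf \<nu>" if "g \<in> Linf \<nu>" "h \<in> Linf \<nu>" for g h
    using that AE_add_le_Linf_norm[OF that]
      borel_measurable_add[OF that[THEN borel_measurable_Linf]]
    by (intro LinfI) (simp_all add: plus_fun_def)
  show "c *\<^sub>R g \<in> Linf \<nu>" if "g \<in> Linf \<nu>" for c g
    using that AE_scale_le_Linf_norm[OF that, of c]
      borel_measurable_times[OF borel_measurable_const borel_measurable_Linf[OF that], of c]
    by (intro LinfI) (simp_all add: scaleR_fun_def)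
qed

interpretation Linf: seminorm_on "Linf \<nu>" "Linf_norm \<nu>" for \<nu>
proof
  show "subspace (Linf \<nu>)" by (rule subspace_Linf)
  show "Linf_norm \<nu> (g + h) \<le> Linf_norm \<nu> g + Linf_norm \<nu> h"
    if "g \<in> Linf \<nu>" "h \<in> Linf \<nu>" for g h
    using that AE_add_le_Linf_norm[OF that] subspace_add[OF subspace_Linf that]
    by (intro Linf_norm_le borel_measurable_Linf add_nonneg_nonneg Linf_norm_nonneg)
  have le: "Linf_norm \<nu> (c *\<^sub>R g) \<le> \<bar>c\<bar> * Linf_norm \<nu> g" if "g \<in> Linf \<nu>" for c g
    using that AE_scale_le_Linf_norm[OF that] subspace_scale[OF subspace_Linf that]
    by (intro Linf_norm_le borel_measurable_Linf mult_nonneg_nonneg Linf_norm_nonneg) auto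
  show "Linf_norm \<nu> (c *\<^sub>R g) = \<bar>c\<bar> * Linf_norm \<nu> g" if g: "g \<in> Linf \<nu>" for c g
  proof (cases "c = 0")
    case True
    have "c *\<^sub>R g \<in> Linf \<nu>"
      using subspace_Linf g by (rule subspace_scale)
    then have "0 \<le> Linf_norm \<nu> (c *\<^sub>R g)" by (rule Linf_norm_nonneg)
    with le[OF g, of c] True show ?thesis by simp
  next
    case False
    \<comment> \<open>The reverse inequality is the upper bound for the scalar \<open>1 / c\<close>,
      applied to the already scaled function.\<close>
    have "Linf_norm \<nu> ((1 / c) *\<^sub>R (c *\<^sub>R g)) \<le> \<bar>1 / c\<bar> * Linf_norm \<nu> (c *\<^sub>R g)"
      using subspace_Linf g by (intro le subspace_scale)
    with False have "\<bar>c\<bar> * Linf_norm \<nu> g \<le> Linf_norm \<nu> (c *\<^sub>R g)"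
      by (simp add: field_simps)
    with le[OF g, of c] show ?thesis by simp
  qed
qed

text \<open>
  A limit along an ultrafilter concentrated on the set where the sum exceeds \<open>r\<close> acts as a
  multiplicative point evaluation there.
\<close>

lemma dual_ball_Linf_norming:
  fixes g :: "nat \<Rightarrow> 'b \<Rightarrow> real"
  assumes g: "\<And>i. i < n \<Longrightarrow> g i \<in> Linf \<nu>" and p: "0 < p"
    and le: "\<And>\<phi>. \<phi> \<in> dual_ball (Linf \<nu>) (Linf_norm \<nu>) \<Longrightarrow> (\<Sum>i<n. \<bar>\<phi> (g i)\<bar> powr p) < r"
  shows "AE x in \<nu>. (\<Sum>i<n. \<bar>g i x\<bar> powr p) \<le> r"
proof (rule ccontr)
  define S where "S x = (\<Sum>i<n. \<bar>g i x\<bar> powr p)" for x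
  assume "\<not> ?thesis"
  \<comment> \<open>The sum exceeds \<open>r\<close> on a set that is not null, so the
    almost-everywhere filter restricted to that set is proper.\<close>
  then have "inf (ae_filter \<nu>) (principal {x. r < S x}) \<noteq> bot"
    by (simp add: trivial_limit_def eventually_inf_principal S_def not_less)
  then obtain U where U: "U \<le> inf (ae_filter \<nu>) (principal {x. r < S x})" "U \<noteq> bot"
    "\<And>P. eventually P U \<or> eventually (\<lambda>x. \<not> P x) U"
    using ex_ultrafilter[of "inf (ae_filter \<nu>) (principal {x. r < S x})"] by auto
  have AE_U: "eventually P U" if "AE x in \<nu>. P x" for P
    using order_trans[OF U(1) inf_le1] that by (rule filter_leD)
  have S_U: "eventually (\<lambda>x. r < S x) U"
    using order_trans[OF U(1) inf_le2] by (simp add: le_principal)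
  define \<phi> where "\<phi> h = Lim U h" for h :: "'b \<Rightarrow> real"
  have lim: "(h \<longlongrightarrow> \<phi> h) U" if h: "h \<in> Linf \<nu>" for h
  proof -
    obtain l where l: "(h \<longlongrightarrow> l) U"
      using ultrafilter_tendsto_bounded[OF U(2,3) AE_U[OF AE_Linf_norm[OF h]]] by blast
    with tendsto_Lim[OF U(2) l] show ?thesis
      by (simp add: \<phi>_def)
  qed
  have "\<phi> \<in> dual_ball (Linf \<nu>) (Linf_norm \<nu>)"
    unfolding dual_ball_def linear_on_def
  proof (intro CollectI conjI ballI allI)
    fix h k assume hk: "h \<in> Linf \<nu>" "k \<in> Linf \<nu>"
    have "((\<lambda>x. h x + k x) \<longlongrightarrow> \<phi> h + \<phi> k) U"
      using lim[OF hk(1)] lim[OF hk(2)] by (rule tendsto_add)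
    from tendsto_Lim[OF U(2) this] show "\<phi> (h + k) = \<phi> h + \<phi> k"
      by (simp add: \<phi>_def plus_fun_def)
  next
    fix c h assume h: "h \<in> Linf \<nu>"
    have "((\<lambda>x. c *\<^sub>R h x) \<longlongrightarrow> c *\<^sub>R \<phi> h) U"
      using tendsto_const lim[OF h] by (rule tendsto_scaleR)
    from tendsto_Lim[OF U(2) this] show "\<phi> (c *\<^sub>R h) = c *\<^sub>R \<phi> h"
      by (simp add: \<phi>_def scaleR_fun_def)
  next
    fix h assume h: "h \<in> Linf \<nu>"
    show "\<bar>\<phi> h\<bar> \<le> Linf_norm \<nu> h"
      using tendsto_upperbound[OF tendsto_rabs[OF lim[OF h]] AE_U[OF AE_Linf_norm[OF h]] U(2)] .
  qed
  then have "(\<Sum>i<n. \<bar>\<phi> (g i)\<bar> powr p) < r" by (rule le)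
  \<comment> \<open>The powers are continuous, so \<open>S\<close> converges along \<open>U\<close>
    to the sum for \<phi>. As \<open>S > r\<close> eventually, the limit is at least
    \<open>r\<close>, against the strict bound assumed for functionals.\<close>
  moreover have "(S \<longlongrightarrow> (\<Sum>i<n. \<bar>\<phi> (g i)\<bar> powr p)) U"
    unfolding S_def using p
    by (intro tendsto_sum tendsto_powr' tendsto_rabs lim g tendsto_const) auto
  then have "r \<le> (\<Sum>i<n. \<bar>\<phi> (g i)\<bar> powr p)"
    using eventually_mono[OF S_U less_imp_le] U(2) by (rule tendsto_lowerbound)
  ultimately show False by simp
qed

lemma sum_fun_apply: "(\<Sum>i\<in>I. f i) x = (\<Sum>i\<in>I. f i x)"
  by (induction I rule: infinite_finite_induct) simp_all

text \<open>With the signs of \<phi> (g i) as coefficients the sum becomes \<phi> of a single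
  function \<open>h\<close>, whose absolute value is dominated pointwise by the weighted sum of the
  \<bar>g i\<bar>.\<close>

lemma dual_ball_Linf_sum_le:
  assumes \<phi>: "\<phi> \<in> dual_ball (Linf \<nu>) (Linf_norm \<nu>)"
    and g: "\<And>i. i < n \<Longrightarrow> g i \<in> Linf \<nu>" and a: "\<And>i. i < n \<Longrightarrow> 0 \<le> a i"
    and le: "AE x in \<nu>. (\<Sum>i<n. a i * \<bar>g i x\<bar>) \<le> B" and B: "0 \<le> B"
  shows "(\<Sum>i<n::nat. a i * \<bar>\<phi> (g i)\<bar>) \<le> B"
proof -
  define s where "s i = a i * sgn (\<phi> (g i))" for i
  have abs_s: "\<bar>s i\<bar> \<le> a i" if "i < n" for i
    using a[OF that] by (auto simp: s_def abs_mult abs_sgn_eq)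
  define h where "h = (\<Sum>i<n. s i *\<^sub>R g i)"
  have sg: "s i *\<^sub>R g i \<in> Linf \<nu>" if "i < n" for i
    using subspace_Linf g[OF that] by (rule subspace_scale)
  have h: "h \<in> Linf \<nu>"
    unfolding h_def using subspace_Linf sg by (intro subspace_sum) auto
  have "h x = (\<Sum>i<n. s i * g i x)" for x
    by (simp add: h_def sum_fun_apply scaleR_fun_def)
  then have h_le: "\<bar>h x\<bar> \<le> (\<Sum>i<n. a i * \<bar>g i x\<bar>)" for x
    using abs_s by (auto simp: abs_mult intro!: sum_abs[THEN order_trans] sum_mono mult_right_mono)
  have "(\<Sum>i<n. a i * \<bar>\<phi> (g i)\<bar>) = (\<Sum>i<n. s i * \<phi> (g i))"
    by (simp add: s_def abs_sgn mult_ac)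
  also have "\<dots> = (\<Sum>i<n. \<phi> (s i *\<^sub>R g i))"
    using Linf.dual_ballD(1)[OF \<phi>] g by (simp add: linear_on_def)
  also have "\<dots> = \<phi> h"
    unfolding h_def using sg by (intro linear_on_sum[OF Linf.dual_ballD(1)[OF \<phi>] subspace_Linf, symmetric]) auto
  also have "\<dots> \<le> Linf_norm \<nu> h"
    using Linf.dual_ballD(2)[OF \<phi> h] by simp
  also have "\<dots> \<le> B"
  proof (rule Linf_norm_le[OF borel_measurable_Linf[OF h] _ B])
    show "AE x in \<nu>. \<bar>h x\<bar> \<le> B"
      using le h_le by (auto elim!: eventually_mono intro: order_trans)
  qed
  finally show ?thesis .
qed

section \<open>Dyadic truncations\<close>

definition trunc :: "('b \<Rightarrow> real) \<Rightarrow> real \<Rightarrow> real \<Rightarrow> 'b \<Rightarrow> real" where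
  "trunc x a b = (\<lambda>w. if a < \<bar>x w\<bar> \<and> \<bar>x w\<bar> \<le> b then x w else 0)"

lemma trunc_in_Linf:
  assumes "x \<in> Linf \<nu>"
  shows "trunc x a b \<in> Linf \<nu>"
proof (rule LinfI)
  show "trunc x a b \<in> borel_measurable \<nu>"
    using borel_measurable_Linf[OF assms] unfolding trunc_def by measurable
  show "AE w in \<nu>. \<bar>trunc x a b w\<bar> \<le> Linf_norm \<nu> x"
    using AE_Linf_norm[OF assms] Linf_norm_nonneg[OF assms] by (auto simp: trunc_def elim: eventually_mono)
qed

lemma Linf_norm_trunc_le:
  assumes "x \<in> Linf \<nu>" "0 \<le> b"
  shows "Linf_norm \<nu> (trunc x a b) \<le> b"
  using borel_measurable_Linf[OF trunc_in_Linf[OF assms(1)]] assms(2)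
  by (intro Linf_norm_le) (auto simp: trunc_def)

text \<open>
  The dyadic truncations of \<open>x\<close> below the level \<open>r = norm (u x) / (2 c)\<close> contribute at most half of
  \<open>norm (u x)\<close>. As the numbers \<open>\<rho> ^ j\<close> are summable, one of the truncations above that level must
  have an image of norm at least a multiple of \<open>\<rho> ^ j * norm (u x)\<close>.
\<close>

lemma dominant_dyadic_truncation:
  fixes u :: "('b \<Rightarrow> real) \<Rightarrow> 'e::real_normed_vector"
  assumes u: "linear_on (Linf \<nu>) u" and c: "0 < c" "\<And>g. g \<in> Linf \<nu> \<Longrightarrow> norm (u g) \<le> c * Linf_norm \<nu> g"
    and pq: "0 < q" "q < p"
  shows "\<exists>K\<ge>0. \<forall>x\<in>Linf \<nu>. \<exists>m>0.
    norm (u x) powr p \<le> K * (m powr (p - q) * norm (u (trunc x (m / 2) m)) powr q)"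
proof -
  \<comment> \<open>The exponent for which the factors \<rho>^j to the power \<open>q\<close> and
    2^j to the power \<open>p - q\<close> cancel. Since \<open>q < p\<close> it is positive, hence
    \<rho> < 1, and \<open>G\<close> is the sum of the geometric series.\<close>
  define \<delta> where "\<delta> = (p - q) / q"
  have \<delta>: "0 < \<delta>" "\<delta> * q = p - q" using pq by (auto simp: \<delta>_def)
  define \<rho> :: real where "\<rho> = 2 powr (-\<delta>)"
  have \<rho>: "0 < \<rho>" "\<rho> < 1" using \<delta>(1) by (simp_all add: \<rho>_def powr_less_one)
  define G where "G = 1 / (1 - \<rho>)"
  have G: "0 < G" using \<rho> by (simp add: G_def)
  define K where "K = (2 * G) powr q * c powr (p - q)"
  show ?thesis
  proof (rule exI[of _ K], intro conjI ballI)
    show "0 \<le> K" by (simp add: K_def)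
    fix x assume x: "x \<in> Linf \<nu>"
    define t where "t = norm (u x)"
    show "\<exists>m>0. norm (u x) powr p \<le> K * (m powr (p - q) * norm (u (trunc x (m / 2) m)) powr q)"
    proof (cases "t = 0")
      case True
      then show ?thesis
        using \<open>0 \<le> K\<close> by (intro exI[of _ 1]) (simp add: t_def)
    next
      case False
      then have t: "0 < t" by (simp add: t_def)
      define r where "r = t / (2 * c)"
      have r: "0 < r" using t c by (simp add: r_def)
      \<comment> \<open>The lower level -1 is no restriction on an absolute value, so
        \<open>z j\<close> keeps all of \<open>x\<close> up to the upper level; consecutive ones
        differ by a dyadic band.\<close>
      define z where "z j = trunc x (-1) (r * 2 ^ j)" for j
      have z: "z j \<in> Linf \<nu>" for j
        unfolding z_def by (rule trunc_in_Linf[OF x])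
      have neg: "-1 < \<bar>v\<bar>" for v :: real
        by (rule less_le_trans[of _ 0]) simp_all
      have step: "z (Suc j) - z j = trunc x (r * 2 ^ j) (r * 2 ^ Suc j)" for j
      proof -
        have "r * 2 ^ j \<le> r * 2 ^ Suc j" using r by simp
        then show ?thesis
          by (intro ext) (auto simp: z_def trunc_def neg)
      qed
      obtain J where J: "Linf_norm \<nu> x / r < 2 ^ J"
        using real_arch_pow[of 2 "Linf_norm \<nu> x / r"] by auto
      \<comment> \<open>The level exceeds the essential supremum, so \<open>z J\<close> and
        \<open>x\<close> agree almost everywhere, and boundedness of \<open>u\<close> gives them
        equal images.\<close>
      have "u (z J) = u x"
      proof -
        have "AE w in \<nu>. \<bar>(z J - x) w\<bar> \<le> 0"
          using AE_Linf_norm[OF x]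
        proof eventually_elim
          case (elim w)
          also have "Linf_norm \<nu> x \<le> r * 2 ^ J"
            using J r by (simp add: field_simps)
          finally show ?case by (simp add: z_def trunc_def neg)
        qed
        then have "Linf_norm \<nu> (z J - x) \<le> 0"
          using z x by (intro Linf_norm_le borel_measurable_Linf subspace_diff subspace_Linf) auto
        then have "norm (u (z J - x)) \<le> 0"
          using c(2)[OF subspace_diff[OF subspace_Linf z x], of J] c(1)
          by (meson mult_nonneg_nonpos less_imp_le order_trans)
        then show ?thesis
          using linear_on_diff[OF u subspace_Linf z x] by simp
      qed
      have "norm (u (z 0)) \<le> c * r"
        using c(2)[OF z, of 0] Linf_norm_trunc_le[OF x, of r "-1"] c(1) r
        by (auto simp: z_def intro: order_trans mult_left_mono)
      also have "c * r = t / 2" using c by (simp add: r_def)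
      finally have z0: "norm (u (z 0)) \<le> t / 2" .
      define y where "y j = trunc x (r * 2 ^ j) (r * 2 ^ Suc j)" for j
      \<comment> \<open>Otherwise telescoping bounds the distance from \<open>u (z 0)\<close> to
        \<open>u x\<close> by a partial geometric sum, which is strictly below \<open>t / 2\<close>,
        while \<open>u (z 0)\<close> has norm at most \<open>t / 2\<close>.\<close>
      have "\<exists>j<J. t * \<rho> ^ j \<le> 2 * G * norm (u (y j))"
      proof (rule ccontr)
        assume "\<not> ?thesis"
        then have small: "norm (u (y j)) \<le> t / (2 * G) * \<rho> ^ j" if "j < J" for j
          using that G by (auto simp: field_simps not_le less_imp_le)
        have "u x - u (z 0) = (\<Sum>j<J. u (z (Suc j)) - u (z j))"
          using \<open>u (z J) = u x\<close> sum_lessThan_telescope[of "\<lambda>j. u (z j)" J] by simp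
        also have "\<dots> = (\<Sum>j<J. u (y j))"
          using linear_on_diff[OF u subspace_Linf z z, symmetric] by (simp add: step y_def)
        finally have "norm (u x - u (z 0)) \<le> (\<Sum>j<J. norm (u (y j)))"
          by (simp add: norm_sum)
        also have "\<dots> \<le> (\<Sum>j<J. t / (2 * G) * \<rho> ^ j)"
          using small by (intro sum_mono) auto
        also have "\<dots> = t / (2 * G) * (\<Sum>j<J. \<rho> ^ j)"
          by (simp add: sum_distrib_left)
        also have "(\<Sum>j<J. \<rho> ^ j) = (1 - \<rho> ^ J) * G"
          using \<rho> by (simp add: geometric_sum G_def field_simps)
        also have "t / (2 * G) * ((1 - \<rho> ^ J) * G) = t / 2 * (1 - \<rho> ^ J)"
          using G by simp
        also have "\<dots> < t / 2"
          using t \<rho> by (simp add: field_simps)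
        finally have "norm (u x - u (z 0)) < t / 2" .
        moreover have "t \<le> norm (u x - u (z 0)) + norm (u (z 0))"
          unfolding t_def by norm
        ultimately show False using z0 by simp
      qed
      then obtain j where j: "t * \<rho> ^ j \<le> 2 * G * norm (u (y j))" by blast
      \<comment> \<open>The upper end of the chosen band; by the choice of \<open>r\<close> it
        satisfies \<open>c * m = t * 2 ^ j\<close>.\<close>
      define m where "m = r * 2 ^ Suc j"
      have m: "0 < m" "c * m = t * 2 ^ j" "trunc x (m / 2) m = y j"
        using r c(1) by (simp add: m_def, simp add: m_def r_def, simp add: m_def y_def)
      have "(\<rho> ^ j) powr q * (2 ^ j) powr (p - q) = (1::real)"
      proof -
        have "(\<rho> ^ j) powr q = 2 powr (- (p - q) * j)"
          using \<rho>(1) by (simp add: \<rho>_def powr_powr flip: powr_realpow \<delta>(2)) (simp add: mult_ac)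
        moreover have "((2::real) ^ j) powr (p - q) = 2 powr ((p - q) * j)"
          by (simp add: powr_powr mult.commute flip: powr_realpow)
        ultimately show ?thesis by (simp add: algebra_simps flip: powr_add)
      qed
      then have "t powr p = (t * \<rho> ^ j) powr q * (t * 2 ^ j) powr (p - q)"
        using t by (simp add: powr_mult mult_ac flip: powr_add)
      also have "\<dots> \<le> (2 * G * norm (u (y j))) powr q * (c * m) powr (p - q)"
        using j t \<rho> pq unfolding m(2) by (intro mult_right_mono powr_mono2) auto
      also have "\<dots> = K * (m powr (p - q) * norm (u (trunc x (m / 2) m)) powr q)"
        by (simp add: K_def m(3) powr_mult mult_ac)
      finally show ?thesis
        using m(1) by (auto simp: t_def)
    qed
  qed
qed

section \<open>From the inequality with exponent \<open>q\<close> to absolute p-summability\<close>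

text \<open>Each \<open>x i\<close> is replaced by its dominant band \<open>y i\<close> at level
  \<open>m i\<close>, rescaled to \<open>Y i\<close>, and the hypothesis is applied to the family
  \<open>Y\<close>. Ultrafilter functionals then relate the essential supremum of the sum of the
  p-th powers to the weak p-norm.\<close>

lemma sum_bound_imp_p_summing:
  fixes u :: "('b \<Rightarrow> real) \<Rightarrow> 'e::real_normed_vector"
  assumes u: "linear_on (Linf \<nu>) u" and q: "1 \<le> q" and pq: "q < p" and K0: "0 < K0"
    and bound: "\<And>(n::nat) x B. (\<And>i. i < n \<Longrightarrow> x i \<in> Linf \<nu>) \<Longrightarrow> 0 \<le> B \<Longrightarrow>
      (\<And>\<phi>. \<phi> \<in> dual_ball (Linf \<nu>) (Linf_norm \<nu>) \<Longrightarrow>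
        (\<Sum>i<n. \<bar>\<phi> (x i)\<bar> * Linf_norm \<nu> (x i) powr (q - 1)) \<le> B) \<Longrightarrow>
      (\<Sum>i<n. norm (u (x i)) powr q) \<le> K0 * B"
  shows "p_summing p (Linf \<nu>) (Linf_norm \<nu>) u"
proof -
  let ?N = "Linf_norm \<nu>"
  let ?D = "dual_ball (Linf \<nu>) ?N"
  \<comment> \<open>For a single vector the hypothesis reads as a bound by \<open>K0\<close> times
    the q-th power of its seminorm.\<close>
  define c where "c = K0 powr (1 / q)"
  have c: "0 < c" using K0 by (simp add: c_def)
  have c_bound: "norm (u g) \<le> c * ?N g" if g: "g \<in> Linf \<nu>" for g
  proof -
    have N: "0 \<le> ?N g" using g by (rule Linf_norm_nonneg)
    have "(\<Sum>i<1::nat. norm (u g) powr q) \<le> K0 * ?N g powr q"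
    proof (rule bound)
      fix \<phi> assume "\<phi> \<in> ?D"
      then have "\<bar>\<phi> g\<bar> * ?N g powr (q - 1) \<le> ?N g powr 1 * ?N g powr (q - 1)"
        using Linf.dual_ballD(2)[OF _ g] N by (intro mult_right_mono) auto
      also have "\<dots> = ?N g powr q"
        using powr_add[of "?N g" 1 "q - 1"] by simp
      finally show "(\<Sum>i<1::nat. \<bar>\<phi> g\<bar> * ?N g powr (q - 1)) \<le> ?N g powr q" by simp
    qed (use g in auto)
    also have "K0 * ?N g powr q = (c * ?N g) powr q"
      using q K0 by (simp add: c_def powr_mult powr_powr)
    finally have "norm (u g) powr q \<le> (c * ?N g) powr q" by simp
    then show ?thesis
      using powr_less_mono2[of q "c * ?N g" "norm (u g)"] q c N by (cases "norm (u g) \<le> c * ?N g") auto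
  qed
  obtain K where K: "0 \<le> K" "\<And>x. x \<in> Linf \<nu> \<Longrightarrow> \<exists>m>0.
      norm (u x) powr p \<le> K * (m powr (p - q) * norm (u (trunc x (m / 2) m)) powr q)"
    using dominant_dyadic_truncation[OF u c c_bound, of q p] q pq by auto
  \<comment> \<open>Rescaling by \<open>m i powr \<delta>\<close> produces the factor
    \<open>m i powr (p - q)\<close> in the q-th power of the norm of \<open>u (Y i)\<close>, and it
    makes the total power of \<open>m i\<close> on the weak side equal to
    \<open>p - 1\<close>.\<close>
  define \<delta> where "\<delta> = (p - q) / q"
  have \<delta>: "0 < \<delta>" "\<delta> * q = p - q" using pq q by (auto simp: \<delta>_def)
  define C where "C = K * K0 * 2 powr (p - 1)"
  have "0 \<le> C" using K K0 by (simp add: C_def)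
  have main: "(\<Sum>i<n. norm (u (x i)) powr p) \<le> C * R"
    if x: "\<And>i. i < n \<Longrightarrow> x i \<in> Linf \<nu>" and R: "0 \<le> R" "AE w in \<nu>. (\<Sum>i<n. \<bar>x i w\<bar> powr p) \<le> R"
    for n :: nat and x R
  proof -
    have "\<forall>i. \<exists>m. i < n \<longrightarrow> 0 < m \<and>
        norm (u (x i)) powr p \<le> K * (m powr (p - q) * norm (u (trunc (x i) (m / 2) m)) powr q)"
      using K(2) x by meson
    then obtain m where m: "\<And>i. i < n \<Longrightarrow> 0 < m i"
      "\<And>i. i < n \<Longrightarrow> norm (u (x i)) powr p
        \<le> K * (m i powr (p - q) * norm (u (trunc (x i) (m i / 2) (m i))) powr q)"
      by metis
    define y where "y i = trunc (x i) (m i / 2) (m i)" for i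
    define Y where "Y i = m i powr \<delta> *\<^sub>R y i" for i
    have y: "y i \<in> Linf \<nu>" if "i < n" for i
      unfolding y_def using x[OF that] by (rule trunc_in_Linf)
    have Y: "Y i \<in> Linf \<nu>" if "i < n" for i
      unfolding Y_def using subspace_Linf y[OF that] by (rule subspace_scale)
    have NY: "?N (Y i) \<le> m i powr (\<delta> + 1)" if i: "i < n" for i
    proof -
      have "?N (Y i) = m i powr \<delta> * ?N (y i)"
        using y[OF i] by (simp add: Y_def Linf.scale)
      also have "\<dots> \<le> m i powr \<delta> * m i"
        using Linf_norm_trunc_le[OF x[OF i], of "m i"] m(1)[OF i]
        by (intro mult_left_mono) (auto simp: y_def)
      also have "\<dots> = m i powr (\<delta> + 1)"
        using m(1)[OF i] by (simp add: powr_add)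
      finally show ?thesis .
    qed
    \<comment> \<open>Where \<open>y i\<close> does not vanish, \<open>m i\<close> is at most twice
      \<bar>x i w\<bar>, so the power \<open>p - 1\<close> of \<open>m i\<close> is absorbed into
      \<bar>x i w\<bar> at the cost of \<open>2 powr (p - 1)\<close>.\<close>
    have pointwise: "?N (Y i) powr (q - 1) * \<bar>Y i w\<bar> \<le> 2 powr (p - 1) * \<bar>x i w\<bar> powr p" if i: "i < n" for i w
    proof (cases "y i w = 0")
      case True
      then show ?thesis by (simp add: Y_def scaleR_fun_def)
    next
      case False
      then have yw: "y i w = x i w" "m i \<le> 2 * \<bar>x i w\<bar>"
        by (auto simp: y_def trunc_def split: if_splits)
      have "?N (Y i) powr (q - 1) \<le> (m i powr (\<delta> + 1)) powr (q - 1)"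
        using NY[OF i] Linf_norm_nonneg[OF Y[OF i]] q by (intro powr_mono2) auto
      then have "?N (Y i) powr (q - 1) * \<bar>Y i w\<bar> \<le> (m i powr (\<delta> + 1)) powr (q - 1) * (m i powr \<delta> * \<bar>x i w\<bar>)"
        by (simp add: Y_def scaleR_fun_def yw abs_mult mult_right_mono)
      also have "\<dots> = m i powr ((\<delta> + 1) * (q - 1) + \<delta>) * \<bar>x i w\<bar>"
        by (metis mult.assoc powr_add powr_powr)
      also have "(\<delta> + 1) * (q - 1) + \<delta> = p - 1"
        using \<delta>(2) by (simp add: algebra_simps)
      also have "m i powr (p - 1) * \<bar>x i w\<bar> \<le> (2 * \<bar>x i w\<bar>) powr (p - 1) * \<bar>x i w\<bar>"
        using yw(2) m(1)[OF i] q pq by (intro mult_right_mono powr_mono2) auto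
      also have "\<dots> = 2 powr (p - 1) * (\<bar>x i w\<bar> powr (p - 1) * \<bar>x i w\<bar> powr 1)"
        by (simp add: powr_mult)
      also have "\<dots> = 2 powr (p - 1) * \<bar>x i w\<bar> powr p"
        using powr_add[of "\<bar>x i w\<bar>" "p - 1" 1] by simp
      finally show ?thesis .
    qed
    have "(\<Sum>i<n. norm (u (Y i)) powr q) \<le> K0 * (2 powr (p - 1) * R)"
    proof (rule bound[OF Y])
      fix \<phi> assume \<phi>: "\<phi> \<in> ?D"
      have "(\<Sum>i<n. ?N (Y i) powr (q - 1) * \<bar>\<phi> (Y i)\<bar>) \<le> 2 powr (p - 1) * R"
      proof (rule dual_ball_Linf_sum_le[OF \<phi> Y])
        show "AE w in \<nu>. (\<Sum>i<n. ?N (Y i) powr (q - 1) * \<bar>Y i w\<bar>) \<le> 2 powr (p - 1) * R"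
          using R(2)
        proof eventually_elim
          case (elim w)
          have "(\<Sum>i<n. ?N (Y i) powr (q - 1) * \<bar>Y i w\<bar>) \<le> (\<Sum>i<n. 2 powr (p - 1) * \<bar>x i w\<bar> powr p)"
            using pointwise by (intro sum_mono) auto
          also have "\<dots> \<le> 2 powr (p - 1) * R"
            using elim by (simp flip: sum_distrib_left)
          finally show ?case .
        qed
      qed (use R in auto)
      then show "(\<Sum>i<n. \<bar>\<phi> (Y i)\<bar> * ?N (Y i) powr (q - 1)) \<le> 2 powr (p - 1) * R"
        by (simp add: mult.commute)
    qed (use R in auto)
    moreover have "norm (u (x i)) powr p \<le> K * norm (u (Y i)) powr q" if i: "i < n" for i
    proof -
      have "norm (u (Y i)) = m i powr \<delta> * norm (u (y i))"
        using u y[OF i] by (simp add: Y_def linear_on_def)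
      then have "norm (u (Y i)) powr q = m i powr (p - q) * norm (u (y i)) powr q"
        by (simp add: powr_mult powr_powr \<delta>(2))
      with m(2)[OF i] show ?thesis by (simp add: y_def)
    qed
    then have "(\<Sum>i<n. norm (u (x i)) powr p) \<le> K * (\<Sum>i<n. norm (u (Y i)) powr q)"
      unfolding sum_distrib_left by (intro sum_mono) auto
    ultimately have "(\<Sum>i<n. norm (u (x i)) powr p) \<le> K * (K0 * (2 powr (p - 1) * R))"
      using K(1) by (meson mult_left_mono order_trans)
    then show ?thesis by (simp add: C_def mult.assoc)
  qed
  have p: "0 < p" using q pq by simp
  show ?thesis
    unfolding p_summing_def
  proof (intro exI[of _ "C powr (1 / p)"] conjI allI impI)
    show "0 \<le> C powr (1 / p)" by simp
    fix n :: nat and x assume x: "\<forall>i<n. x i \<in> Linf \<nu>"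
    define f where "f \<phi> = (\<Sum>i<n. \<bar>\<phi> (x i)\<bar> powr p) powr (1 / p)" for \<phi>
    define S where "S = (SUP \<phi>\<in>?D. f \<phi>)"
    \<comment> \<open>The supremum is a real one, so it dominates its terms only once the set is
      known to be bounded.\<close>
    have "bdd_above (f ` ?D)"
    proof (rule bdd_aboveI2)
      fix \<phi> assume "\<phi> \<in> ?D"
      then show "f \<phi> \<le> (\<Sum>i<n. ?N (x i) powr p) powr (1 / p)"
        unfolding f_def using p x Linf.dual_ballD(2)[of \<phi>]
        by (intro powr_mono2 sum_mono sum_nonneg) auto
    qed
    then have fS: "f \<phi> \<le> S" if "\<phi> \<in> ?D" for \<phi>
      unfolding S_def using that by (rule cSUP_upper[rotated])
    have S: "0 \<le> S"
      using fS[OF Linf.zero_in_dual_ball] by (rule order_trans[rotated]) (simp add: f_def)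
    have le_S: "(\<Sum>i<n. \<bar>\<phi> (x i)\<bar> powr p) \<le> S powr p" if "\<phi> \<in> ?D" for \<phi>
    proof -
      have "f \<phi> powr p \<le> S powr p"
        using fS[OF that] p by (intro powr_mono2) (auto simp: f_def)
      then show ?thesis
        using p by (simp add: f_def powr_powr sum_nonneg)
    qed
    have "(\<Sum>i<n. norm (u (x i)) powr p) \<le> C * S powr p"
    proof (rule field_le_epsilon)
      fix e :: real assume e: "0 < e"
      \<comment> \<open>The passage from functionals to almost every point asks for a strict bound,
        so \<open>S powr p\<close> is enlarged; dividing by \<open>C + 1\<close> keeps the error
        after multiplication by \<open>C\<close> at most \<open>e\<close>.\<close>
      define R where "R = S powr p + e / (C + 1)"
      have R: "S powr p < R" using e \<open>0 \<le> C\<close> by (simp add: R_def)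
      have "AE w in \<nu>. (\<Sum>i<n. \<bar>x i w\<bar> powr p) \<le> R"
        using x p le_S R by (intro dual_ball_Linf_norming) (auto intro: le_less_trans)
      moreover have "0 \<le> R"
        using R powr_ge_zero[of S p] by linarith
      ultimately have "(\<Sum>i<n. norm (u (x i)) powr p) \<le> C * R"
        using x by (intro main) auto
      also have "\<dots> \<le> C * S powr p + e"
        using e \<open>0 \<le> C\<close> by (simp add: R_def field_simps)
      finally show "(\<Sum>i<n. norm (u (x i)) powr p) \<le> C * S powr p + e" .
    qed
    then have "(\<Sum>i<n. norm (u (x i)) powr p) powr (1 / p) \<le> (C * S powr p) powr (1 / p)"
      using p by (intro powr_mono2) (auto intro: sum_nonneg)
    also have "\<dots> = C powr (1 / p) * S"
      using p S by (simp add: powr_mult powr_powr)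
    finally show "(\<Sum>i<n. norm (u (x i)) powr p) powr (1 / p)
        \<le> C powr (1 / p) * (SUP \<phi>\<in>?D. (\<Sum>i<n. \<bar>\<phi> (x i)\<bar> powr p) powr (1 / p))"
      unfolding S_def f_def .
  qed
qed

text \<open>The operator acts on representatives, and compatibility with almost-everywhere equality
  makes it an operator on classes. Writing \<sigma> as \<open>1 - 1 / q\<close> includes
  \<open>q = 1\<close>, where the conjugate exponent is infinite and \<sigma> is 0.\<close>

theorem corollary12:
  fixes \<mu> :: "'w measure" and \<nu> :: "'b measure"
    and u :: "('b \<Rightarrow> real) \<Rightarrow> 'e::banach" and p q \<sigma> :: real
  assumes "finite_measure \<mu>" and "non_atomic \<mu>" and "emeasure \<mu> (space \<mu>) > 0"
    and "1 \<le> q" and "q < p" and "\<sigma> = 1 - 1 / q"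
    and "linear_on (Linf \<nu>) u"
    and "\<And>g h. g \<in> Linf \<nu> \<Longrightarrow> h \<in> Linf \<nu> \<Longrightarrow> (AE x in \<nu>. g x = h x) \<Longrightarrow> u g = u h"
  shows "((\<forall>f\<in>pettis_sigma_space q \<sigma> \<mu> (Linf \<nu>) (Linf_norm \<nu>).
              u \<circ> f \<in> bochner_space q \<mu> UNIV norm) \<and>
          continuous_wrt (pettis_sigma_space q \<sigma> \<mu> (Linf \<nu>) (Linf_norm \<nu>))
            (pettis_sigma_norm q \<sigma> \<mu> (Linf \<nu>) (Linf_norm \<nu>)) (bochner_norm q \<mu> norm)
            (\<lambda>f. u \<circ> f)
          \<longrightarrow> p_summing p (Linf \<nu>) (Linf_norm \<nu>) u)
       \<and> (p_summing q (Linf \<nu>) (Linf_norm \<nu>) u \<longrightarrow>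
          (\<forall>f\<in>pettis_sigma_space q \<sigma> \<mu> (Linf \<nu>) (Linf_norm \<nu>).
              u \<circ> f \<in> bochner_space q \<mu> UNIV norm) \<and>
          continuous_wrt (pettis_sigma_space q \<sigma> \<mu> (Linf \<nu>) (Linf_norm \<nu>))
            (pettis_sigma_norm q \<sigma> \<mu> (Linf \<nu>) (Linf_norm \<nu>)) (bochner_norm q \<mu> norm)
            (\<lambda>f. u \<circ> f))"
proof (intro conjI impI; (elim conjE)?)
  have \<sigma>: "0 \<le> \<sigma>" "\<sigma> \<le> 1"
    using assms(4) by (simp_all add: assms(6))
  show "p_summing p (Linf \<nu>) (Linf_norm \<nu>) u"
    if cont: "continuous_wrt (pettis_sigma_space q \<sigma> \<mu> (Linf \<nu>) (Linf_norm \<nu>))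
        (pettis_sigma_norm q \<sigma> \<mu> (Linf \<nu>) (Linf_norm \<nu>)) (bochner_norm q \<mu> norm) (\<lambda>f. u \<circ> f)"
  proof -
    obtain K where K: "0 < K" "\<forall>(n::nat) x B. (\<forall>i<n. x i \<in> Linf \<nu>) \<longrightarrow> 0 \<le> B \<longrightarrow>
        (\<forall>\<phi>\<in>dual_ball (Linf \<nu>) (Linf_norm \<nu>).
          (\<Sum>i<n. \<bar>\<phi> (x i)\<bar> * Linf_norm \<nu> (x i) powr (q - 1)) \<le> B) \<longrightarrow>
        (\<Sum>i<n. norm (u (x i)) powr q) \<le> K * B"
      using Linf.continuous_compose_imp_sum_bound[OF assms(1-4,6,7) cont] by blast
    show ?thesis
      by (rule sum_bound_imp_p_summing[OF assms(7,4,5) K(1)]) (use K(2) in blast)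
  qed
  assume u: "p_summing q (Linf \<nu>) (Linf_norm \<nu>) u"
  show "\<forall>f\<in>pettis_sigma_space q \<sigma> \<mu> (Linf \<nu>) (Linf_norm \<nu>). u \<circ> f \<in> bochner_space q \<mu> UNIV norm"
    and "continuous_wrt (pettis_sigma_space q \<sigma> \<mu> (Linf \<nu>) (Linf_norm \<nu>))
      (pettis_sigma_norm q \<sigma> \<mu> (Linf \<nu>) (Linf_norm \<nu>)) (bochner_norm q \<mu> norm) (\<lambda>f. u \<circ> f)"
    using Linf.p_summing_imp_continuous_compose[OF assms(1,4) \<sigma> u assms(7)] by blast+
qed

end
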